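(* Let $\gamma\ge 0$ and consider the many-to-many communication task described in the context. For each $n$ let $C_n>0$ satisfy $$\frac{C_n}{n^\gamma}<\frac12\ \text{ for all sufficiently large } n,\qquad a\,n\Big(\frac{C_n}{n^\gamma}\Big)^2+\ln\frac{C_n}{n^\gamma}\to\infty,$$ where $a=\frac{1}{2^{13}\pi}\ln\frac{e}{2}$. Then for any $n$, any $D_n>0$ and any source-destination set $\mathcal{P}_n$ there exists a system $\mathcal{S}_n(\mathcal{P}_n)$ with throughput $\lambda_n(\mathcal{P}_n)$ such that for any packet size $W>0$, as $n\to\infty$, $$\Pr\big(\mathcal{S}_n(\mathcal{P}_n)\text{ is DC}(C_n,D_n)\text{-successful}\big)\to 1$$ and $$\Pr\Big(\lambda_n(\mathcal{P}_n)\ge\frac{W}{c\,n^{1-\gamma}C_n(2+D_n)^2}\Big)\to1,$$ where $c=27\times 2^{14}$ and probabilities are over the random source-destination set.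
   Context: Network model: $A_n\subset\mathbb{R}^2$ is a disk of radius $n^\gamma$. Nodes $s_1,\dots,s_n$ are drawn i.i.d. uniformly on $A_n$; for each $i$, a destination $d_i$ is chosen uniformly from $\{s_j:j\ne i\}$, independently of everything else. $\mathcal{P}_n=\{(s_1,d_1),\dots,(s_n,d_n)\}$. Time is slotted; each node transmits at most one packet of $W$ bits per slot. A route for $(s_i,d_i)$ is a sequence of hops $(t_{i,j},r_{i,j})$, $j=1,\dots,J_i$, of nodes with $t_{i,1}=s_i$, $r_{i,j}=t_{i,j+1}$, $r_{i,J_i}=d_i$, no node repeated. A schedule assigns each hop a positive integer slot $\sigma_{i,j}$. A system is a set of $n$ scheduled routes, one per pair, which is compatible: no node is required to transmit two hops in the same slot. Its period is $p=\max_{i,j}\sigma_{i,j}$, and its throughput is $\lambda=W/p$. For each slot $j$, $\mathcal{H}_j$ is the set of hops scheduled in slot $j$ and $T_j$ the set of their transmitters. A system is successful under a criterion if for every slot $j$ and every hop $(t,r)\in\mathcal{H}_j$, the criterion holds for $(t,r,T_j\setminus\{t\})$. Distance-based criterion DC$(C,D)$ ($C,D>0$): $(t,r,T)$, with $t,r\in\mathbb{R}^2$ and $T$ a finite subset of $\mathbb{R}^2$, satisfies DC$(C,D)$ if $\|t-r\|\le C$ and $\|t'-t''\|\ge C(2+D)$ for all distinct $t',t''\in T\cup\{t\}$. *)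

theory Defs
  imports "HOL-Probability.Probability"
begin

type_synonym point = "real ^ 2"

text \<open>A hop is a triple (transmitter node, receiver node, slot). Nodes are indices 0..n-1;
  node i is the source s_i and sits at position s i.\<close>
type_synonym hop = "nat \<times> nat \<times> nat"

text \<open>A system assigns to each pair i < n a scheduled route (list of hops).\<close>
type_synonym net_system = "nat \<Rightarrow> hop list"

definition hop_tx :: "hop \<Rightarrow> nat" where "hop_tx h = fst h"
definition hop_rx :: "hop \<Rightarrow> nat" where "hop_rx h = fst (snd h)"
definition hop_slot :: "hop \<Rightarrow> nat" where "hop_slot h = snd (snd h)"

definition valid_route :: "nat \<Rightarrow> nat \<Rightarrow> nat \<Rightarrow> hop list \<Rightarrow> bool" where
  "valid_route n src dst R \<longleftrightarrow>
     R \<noteq> [] \<and> hop_tx (hd R) = src \<and> hop_rx (last R) = dst \<and>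
     (\<forall>j. Suc j < length R \<longrightarrow> hop_rx (R ! j) = hop_tx (R ! Suc j)) \<and>
     distinct (map hop_tx R @ [hop_rx (last R)]) \<and>
     (\<forall>h\<in>set R. hop_tx h < n \<and> hop_rx h < n \<and> 1 \<le> hop_slot h)"

definition compatible :: "nat \<Rightarrow> net_system \<Rightarrow> bool" where
  "compatible n S \<longleftrightarrow>
     (\<forall>i<n. \<forall>i'<n. \<forall>j<length (S i). \<forall>j'<length (S i').
        (i, j) \<noteq> (i', j') \<and> hop_slot (S i ! j) = hop_slot (S i' ! j')
        \<longrightarrow> hop_tx (S i ! j) \<noteq> hop_tx (S i' ! j'))"

definition is_system :: "nat \<Rightarrow> (nat \<Rightarrow> nat) \<Rightarrow> net_system \<Rightarrow> bool" where
  "is_system n d S \<longleftrightarrow> (\<forall>i<n. valid_route n i (d i) (S i)) \<and> compatible n S"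

definition is_dest_map :: "nat \<Rightarrow> (nat \<Rightarrow> nat) \<Rightarrow> bool" where
  "is_dest_map n d \<longleftrightarrow> (\<forall>i<n. d i < n \<and> d i \<noteq> i)"

definition period :: "nat \<Rightarrow> net_system \<Rightarrow> nat" where
  "period n S = Max {hop_slot h | h i. i < n \<and> h \<in> set (S i)}"

definition throughput :: "real \<Rightarrow> nat \<Rightarrow> net_system \<Rightarrow> real" where
  "throughput W n S = W / real (period n S)"

definition hops_in_slot :: "nat \<Rightarrow> net_system \<Rightarrow> nat \<Rightarrow> (nat \<times> nat) set" where
  "hops_in_slot n S k = {(hop_tx h, hop_rx h) | h i. i < n \<and> h \<in> set (S i) \<and> hop_slot h = k}"

definition transmitters :: "nat \<Rightarrow> net_system \<Rightarrow> nat \<Rightarrow> nat set" where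
  "transmitters n S k = fst ` hops_in_slot n S k"

definition DC :: "real \<Rightarrow> real \<Rightarrow> point \<Rightarrow> point \<Rightarrow> point set \<Rightarrow> bool" where
  "DC C D t r T \<longleftrightarrow> norm (t - r) \<le> C \<and>
     (\<forall>t'\<in>insert t T. \<forall>t''\<in>insert t T. t' \<noteq> t'' \<longrightarrow> norm (t' - t'') \<ge> C * (2 + D))"

definition successful ::
  "(point \<Rightarrow> point \<Rightarrow> point set \<Rightarrow> bool) \<Rightarrow> nat \<Rightarrow> (nat \<Rightarrow> point) \<Rightarrow> net_system \<Rightarrow> bool" where
  "successful crit n pos S \<longleftrightarrow>
     (\<forall>k. \<forall>(t, r)\<in>hops_in_slot n S k. crit (pos t) (pos r) (pos ` (transmitters n S k - {t})))"

definition sd_space :: "real \<Rightarrow> nat \<Rightarrow> ((nat \<Rightarrow> point) \<times> (nat \<Rightarrow> nat)) measure" where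
  "sd_space \<gamma> n =
     (PiM {..<n} (\<lambda>_. uniform_measure lborel (cball (0::point) (real n powr \<gamma>))))
     \<Otimes>\<^sub>M (PiM {..<n} (\<lambda>i. measure_pmf (pmf_of_set ({..<n} - {i}))))"

end

theory Submission
  imports Defs "HOL-Library.Transitive_Closure_Table"
begin

text \<open>Cut the plane into square cells of side \<open>h = C / 6\<close>.  Since \<open>n (C / R)\<^sup>2\<close> dominates
  \<open>ln (R / C)\<close>, with high probability every cell inside the disk of radius \<open>R\<close> contains a node and every row and
  column of cells contains \<open>O(n C / R)\<close> sources and destinations.  Each pair is then routed through one
  relay per cell along the row of one endpoint and the column of the other.  A cell is crossed only by
  routes having an endpoint in its row or column, so it carries \<open>O(n C / R)\<close> transmissions.  Colouring
  the cells modulo \<open>k = O(2 + D)\<close> in both coordinates separates the cells that are active in the same slot,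
  so \<open>O((2 + D)\<^sup>2 n C / R)\<close> slots suffice.\<close>

section \<open>Scheduling routes on a coloured grid\<close>

text \<open>The boundary dictates the side \<open>C / 6\<close>. A cell cut by the circle may have
  tiny area and stay empty, so its points are assigned to a nearby cell lying wholly inside the
  disk. This costs up to 3/2 of a side at each end of a hop, on top of at most 9/4 sides between
  anchors in adjacent cells: 21/4 in all, rounded up to 6. Relays are needed in all of the order of
  (R/C)^2 inner cells, each empty with probability at most exp(- n (C/R)^2 / (36 pi)). The
  hypothesis makes (R/C) exp(- a n (C/R)^2) tend to 0, and \<open>a\<close> is so small that a
  multiple of the square of this quantity exceeds the union bound. Rows and columns number only the
  order of R/C and are overfull with probability at most exp(- 2 n C/R), so there the first power is
  enough. The good event does not mention \<open>D\<close>, hence one event serves every separation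
  parameter. Outside it some system must still be given, and since \<open>measure\<close> is 0 on
  non-measurable sets, both events of the theorem have to be proved measurable although the
  schedules come from a choice operator.\<close>

definition adjacent :: "int \<times> int \<Rightarrow> int \<times> int \<Rightarrow> bool" where
  "adjacent u v \<longleftrightarrow> \<bar>fst u - fst v\<bar> + \<bar>snd u - snd v\<bar> \<le> 1"

text \<open>The last node of a route sends nothing, hence \<open>butlast\<close>. Routes will repeat
  no node, so a route index together with a transmitter names a single hop.\<close>

definition transmissions :: "nat \<Rightarrow> (nat \<Rightarrow> nat list) \<Rightarrow> (nat \<Rightarrow> 'c) \<Rightarrow> 'c \<Rightarrow> (nat \<times> nat) set" where
  "transmissions n route \<kappa> v = {(i, a). i < n \<and> a \<in> set (butlast (route i)) \<and> \<kappa> a = v}"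

lemma finite_transmissions: "finite (transmissions n route \<kappa> v)"
  by (rule finite_subset[of _ "\<Union>i<n. Pair i ` set (butlast (route i))"])
     (auto simp: transmissions_def)

lemma distinct_nth_butlast_eq:
  assumes "distinct xs" "j < length xs - 1" "j' < length xs - 1" "xs ! j = xs ! j'"
  shows "j = j'"
  using assms by (metis diff_le_self less_le_trans nth_eq_iff_index_eq)

text \<open>All cells of one colour share a block of \<open>L\<close> slots, and inside the block
  each cell numbers its own at most \<open>L\<close> transmissions injectively. Two hops in one slot
  thus either coincide or start in different cells of equal colour, and \<open>far\<close> then
  separates them. The \<open>k * k\<close> colours give the bound on the period.\<close>

lemma schedule_exists:
  fixes pos :: "nat \<Rightarrow> point" and \<kappa> :: "nat \<Rightarrow> int \<times> int" and k :: nat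
  assumes "0 < n" and "0 < k"
    and route: "\<And>i. i < n \<Longrightarrow> distinct (route i) \<and> 2 \<le> length (route i) \<and> hd (route i) = i \<and>
                  last (route i) = d i \<and> set (route i) \<subseteq> {..<n}"
    and hop: "\<And>i j. i < n \<Longrightarrow> Suc j < length (route i) \<Longrightarrow>
                norm (pos (route i ! j) - pos (route i ! Suc j)) \<le> C"
    and load: "\<And>v. card (transmissions n route \<kappa> v) \<le> L"
    and far: "\<And>a b. a < n \<Longrightarrow> b < n \<Longrightarrow> \<kappa> a \<noteq> \<kappa> b \<Longrightarrow>
                fst (\<kappa> a) mod int k = fst (\<kappa> b) mod int k \<Longrightarrow>
                snd (\<kappa> a) mod int k = snd (\<kappa> b) mod int k \<Longrightarrow> C * (2 + D) \<le> norm (pos a - pos b)"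
  shows "\<exists>S. is_system n d S \<and> successful (DC C D) n pos S \<and> period n S \<le> k * k * L"
proof -
  have "\<exists>f. inj_on f (transmissions n route \<kappa> v) \<and> f ` transmissions n route \<kappa> v \<subseteq> {..<L}" for v
    using card_le_inj[OF finite_transmissions finite_lessThan, of n route \<kappa> v L] load[of v] by auto
  then obtain f where f_inj: "\<And>v. inj_on (f v) (transmissions n route \<kappa> v)"
    and f_less: "\<And>v x. x \<in> transmissions n route \<kappa> v \<Longrightarrow> f v x < L"
    by (metis image_subset_iff lessThan_iff)
  define colour where
    "colour v = nat (fst v mod int k) * k + nat (snd v mod int k)" for v :: "int \<times> int"
  have colour_less: "colour v < k * k" for v
  proof -
    have "nat (fst v mod int k) < k" "nat (snd v mod int k) < k"
      using \<open>0 < k\<close> by (auto simp: nat_less_iff)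
    then have "nat (fst v mod int k) \<le> k - 1" "nat (snd v mod int k) < k" by linarith+
    then have "colour v < (k - 1) * k + k"
      unfolding colour_def by (meson add_le_less_mono mult_le_mono1)
    then show ?thesis using \<open>0 < k\<close> by (simp add: algebra_simps)
  qed
  have colour_eq: "fst u mod int k = fst v mod int k \<and> snd u mod int k = snd v mod int k"
    if "colour u = colour v" for u v
  proof -
    have lt: "nat (snd w mod int k) < k" for w :: "int \<times> int"
      using \<open>0 < k\<close> by (auto simp: nat_less_iff)
    have "nat (fst u mod int k) = colour u div k" "nat (snd u mod int k) = colour u mod k"
      "nat (fst v mod int k) = colour v div k" "nat (snd v mod int k) = colour v mod k"
      using lt[of u] lt[of v] by (auto simp: colour_def)
    then show ?thesis using that \<open>0 < k\<close> by (metis eq_nat_nat_iff pos_mod_sign of_nat_0_less_iff)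
  qed
  \<comment> \<open>The colour selects the block and \<open>f\<close> the place inside it;
    \<open>Suc\<close> makes the slots start at 1.\<close>
  define slot where "slot i a = Suc (colour (\<kappa> a) * L + f (\<kappa> a) (i, a))" for i a
  have in_tr: "(i, route i ! j) \<in> transmissions n route \<kappa> (\<kappa> (route i ! j))"
    if "i < n" "j < length (route i) - 1" for i j
    using that by (auto simp: transmissions_def in_set_conv_nth nth_butlast)
  have slot_le: "slot i a \<le> k * k * L" if "(i, a) \<in> transmissions n route \<kappa> (\<kappa> a)" for i a
  proof -
    have "slot i a \<le> colour (\<kappa> a) * L + L"
      using f_less[OF that] by (simp add: slot_def)
    also have "\<dots> = Suc (colour (\<kappa> a)) * L" by simp
    also have "\<dots> \<le> k * k * L" using colour_less[of "\<kappa> a"] by (intro mult_le_mono1) simp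
    finally show ?thesis .
  qed
  have slot_eq: "colour (\<kappa> a) = colour (\<kappa> b) \<and> f (\<kappa> a) (i, a) = f (\<kappa> b) (i', b)"
    if "(i, a) \<in> transmissions n route \<kappa> (\<kappa> a)" "(i', b) \<in> transmissions n route \<kappa> (\<kappa> b)"
      "slot i a = slot i' b" for i i' a b
  proof -
    have lt: "f (\<kappa> a) (i, a) < L" "f (\<kappa> b) (i', b) < L"
      using f_less that by auto
    have eq: "colour (\<kappa> a) * L + f (\<kappa> a) (i, a) = colour (\<kappa> b) * L + f (\<kappa> b) (i', b)"
      using that(3) by (simp add: slot_def)
    have "colour (\<kappa> a) = (colour (\<kappa> a) * L + f (\<kappa> a) (i, a)) div L"
      using lt(1) by simp
    also have "\<dots> = (colour (\<kappa> b) * L + f (\<kappa> b) (i', b)) div L"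
      by (simp only: eq)
    also have "\<dots> = colour (\<kappa> b)" using lt(2) by simp
    finally show ?thesis using eq by simp
  qed
  have slot_same_cell: "(i, a) = (i', b)"
    if "(i, a) \<in> transmissions n route \<kappa> (\<kappa> a)" "(i', b) \<in> transmissions n route \<kappa> (\<kappa> b)"
      "slot i a = slot i' b" "\<kappa> a = \<kappa> b" for i i' a b
    using slot_eq[OF that(1-3)] that f_inj[of "\<kappa> a"] by (metis inj_on_def)
  define S :: net_system where
    "S i = map (\<lambda>j. (route i ! j, route i ! Suc j, slot i (route i ! j))) [0..<length (route i) - 1]" for i
  have len: "length (S i) = length (route i) - 1" for i
    by (simp add: S_def)
  have nth: "S i ! j = (route i ! j, route i ! Suc j, slot i (route i ! j))"
    if "j < length (route i) - 1" for i j
    using that by (simp add: S_def)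
  have setS: "set (S i) = (\<lambda>j. (route i ! j, route i ! Suc j, slot i (route i ! j))) ` {..<length (route i) - 1}" for i
    by (auto simp: S_def)
  have valid: "valid_route n i (d i) (S i)" if "i < n" for i
  proof -
    have r: "distinct (route i)" "2 \<le> length (route i)" "hd (route i) = i"
      "last (route i) = d i" "set (route i) \<subseteq> {..<n}" using route[OF that] by auto
    have ne: "S i \<noteq> []" using r(2) by (auto simp: S_def)
    have last: "hop_rx (last (S i)) = d i"
    proof -
      have "last (S i) = S i ! (length (route i) - 2)"
        using ne by (simp add: last_conv_nth len numeral_2_eq_2)
      also have "hop_rx \<dots> = route i ! (length (route i) - 1)"
        using r by (subst nth) (auto simp: hop_rx_def Suc_diff_le numeral_2_eq_2 Suc_diff_Suc)
      also have "\<dots> = d i" using r by (metis last_conv_nth list.size(3) not_numeral_le_zero)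
      finally show ?thesis .
    qed
    have tx: "map hop_tx (S i) = butlast (route i)"
      by (intro nth_equalityI) (auto simp: len nth hop_tx_def nth_butlast)
    have "distinct (map hop_tx (S i) @ [hop_rx (last (S i))])"
      using r unfolding tx last
      by (metis append_butlast_last_id list.size(3) not_numeral_le_zero)
    moreover have "hop_tx (hd (S i)) = i"
      using ne r len[of i] by (simp add: hd_conv_nth nth hop_tx_def) (metis hd_conv_nth list.size(3) not_numeral_le_zero)
    moreover have "\<forall>h\<in>set (S i). hop_tx h < n \<and> hop_rx h < n \<and> 1 \<le> hop_slot h"
    proof -
      have "route i ! j < n" if "j < length (route i)" for j
        using r(5) that nth_mem by blast
      then show ?thesis by (auto simp: setS hop_tx_def hop_rx_def hop_slot_def slot_def)
    qed
    ultimately show ?thesis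
      using ne last unfolding valid_route_def
      by (auto simp: len nth hop_tx_def hop_rx_def)
  qed
  have "compatible n S"
    unfolding compatible_def
  proof (intro allI impI)
    fix i i' j j'
    assume i: "i < n" "i' < n" and j: "j < length (S i)" "j' < length (S i')"
      and *: "(i, j) \<noteq> (i', j') \<and> hop_slot (S i ! j) = hop_slot (S i' ! j')"
    show "hop_tx (S i ! j) \<noteq> hop_tx (S i' ! j')"
    proof
      assume eq: "hop_tx (S i ! j) = hop_tx (S i' ! j')"
      have j': "j < length (route i) - 1" "j' < length (route i') - 1" using j len by auto
      \<comment> \<open>A common transmitter means a common cell, and there a slot holds a single
        transmission.\<close>
      have "(i, route i ! j) = (i', route i' ! j')"
        using i j' eq * by (intro slot_same_cell in_tr) (auto simp: nth hop_tx_def hop_slot_def)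
      then show False using * j' i route[of i] distinct_nth_butlast_eq[of "route i" j j'] by auto
    qed
  qed
  moreover have "successful (DC C D) n pos S"
    unfolding successful_def
  proof (intro allI ballI, clarify)
    fix m t r assume tr: "(t, r) \<in> hops_in_slot n S m"
    have tx: "\<exists>i<n. \<exists>j<length (route i) - 1. t' = route i ! j \<and> slot i t' = m"
      if "t' \<in> insert t (transmitters n S m)" for t'
      using that tr
      by (auto simp: transmitters_def hops_in_slot_def setS hop_tx_def hop_rx_def hop_slot_def; blast)
    have hop_tr: "norm (pos t - pos r) \<le> C"
      using tr hop by (auto simp: hops_in_slot_def setS hop_tx_def hop_rx_def)
    have sep: "C * (2 + D) \<le> norm (pos t' - pos t'')"
      if t: "t' \<in> insert t (transmitters n S m)" "t'' \<in> insert t (transmitters n S m)"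
        and ne: "pos t' \<noteq> pos t''" for t' t''
    proof -
      obtain i j where i: "i < n" "j < length (route i) - 1" "t' = route i ! j" "slot i t' = m"
        using tx[OF t(1)] by blast
      obtain i' j' where i': "i' < n" "j' < length (route i') - 1" "t'' = route i' ! j'" "slot i' t'' = m"
        using tx[OF t(2)] by blast
      have tr: "(i, t') \<in> transmissions n route \<kappa> (\<kappa> t')" "(i', t'') \<in> transmissions n route \<kappa> (\<kappa> t'')"
        using in_tr i i' by auto
      have "slot i t' = slot i' t''" using i i' by simp
      \<comment> \<open>Distinct positions belong to distinct transmitters, which in a common slot
        must come from distinct cells; the common slot also forces equal colours.\<close>
      then have "\<kappa> t' \<noteq> \<kappa> t''" "colour (\<kappa> t') = colour (\<kappa> t'')"
        using slot_same_cell[OF tr] slot_eq[OF tr] ne by auto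
      moreover have "t' < n" "t'' < n"
        using route[of i] route[of i'] i i' by (auto simp: subset_iff)
      ultimately show ?thesis using far colour_eq by blast
    qed
    show "DC C D (pos t) (pos r) (pos ` (transmitters n S m - {t}))"
      unfolding DC_def using hop_tr sep by auto
  qed
  moreover have "period n S \<le> k * k * L"
  proof -
    let ?A = "{hop_slot h | h i. i < n \<and> h \<in> set (S i)}"
    have "?A = (\<Union>i<n. hop_slot ` set (S i))" by auto
    then have "finite ?A" by simp
    moreover have "hd (S 0) \<in> set (S 0)"
      using valid[of 0] \<open>0 < n\<close> by (simp add: valid_route_def)
    then have "?A \<noteq> {}" using \<open>0 < n\<close> by blast
    moreover have "x \<le> k * k * L" if "x \<in> ?A" for x
      using that by (auto simp: setS hop_slot_def intro!: slot_le in_tr)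
    ultimately show ?thesis unfolding period_def by (intro Max.boundedI) auto
  qed
  ultimately show ?thesis using valid unfolding is_system_def by blast
qed

section \<open>Routes through the cells inside a disk\<close>

text \<open>The largest absolute value on the closed interval from \<open>c\<close> to
  \<open>c + 1\<close>. The sum of squares in \<open>inner_cell\<close> is then the squared distance
  from the origin to the farthest corner of a unit cell, so inner cells are those contained in the
  disk of radius \<open>q\<close>.\<close>

definition extent :: "int \<Rightarrow> real" where
  "extent c = max \<bar>of_int c\<bar> \<bar>of_int c + 1\<bar>"

definition inner_cell :: "real \<Rightarrow> int \<times> int \<Rightarrow> bool" where
  "inner_cell q v \<longleftrightarrow> (extent (fst v))\<^sup>2 + (extent (snd v))\<^sup>2 \<le> q\<^sup>2"

lemma extent_nonneg: "0 \<le> extent c"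
  by (simp add: extent_def)

text \<open>Moving away from the origin on either side never decreases \<open>extent\<close>, so it
  is quasi-convex. This keeps a straight walk of cells inside the disk when both of its ends
  are.\<close>

lemma extent_between:
  assumes "a \<le> c" "c \<le> b"
  shows "extent c \<le> max (extent a) (extent b)"
proof (cases "0 \<le> c")
  case True
  then have "extent c = of_int c + 1" "of_int b + 1 \<le> extent b" "of_int c + 1 \<le> (of_int b + 1 :: real)"
    using assms by (auto simp: extent_def)
  then show ?thesis by linarith
next
  case False
  then have "extent c = - of_int c" "- of_int a \<le> extent a" "- of_int c \<le> (- of_int a :: real)"
    using assms by (auto simp: extent_def)
  then show ?thesis by linarith
qed

lemma rtranclp_int_interval:
  fixes a b :: int
  assumes "\<And>c. a \<le> c \<Longrightarrow> c < b \<Longrightarrow> r (f c) (f (c + 1))" "a \<le> b"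
  shows "r\<^sup>*\<^sup>* (f a) (f b)"
  using assms(2,1)
proof (induction b rule: int_ge_induct)
  case base
  then show ?case by simp
next
  case (step b)
  then have "r\<^sup>*\<^sup>* (f a) (f b)" by auto
  also have "r (f b) (f (b + 1))" using step by auto
  finally show ?case .
qed

text \<open>Each endpoint shares its column or its row with a corner cell \<open>(c, r)\<close>, so
  a straight walk of relays joins it to the relay of the corner. Joining the two walks may repeat
  nodes; passing to reachability and erasing loops yields the distinct path that a route
  requires.\<close>

lemma route_exists:
  fixes \<kappa> :: "nat \<Rightarrow> int \<times> int"
  assumes relay: "\<And>v. inner_cell q v \<Longrightarrow> relay v < n \<and> \<kappa> (relay v) = v"
    and ij: "i < n" "j < n" "i \<noteq> j" and inner: "inner_cell q (\<kappa> i)" "inner_cell q (\<kappa> j)"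
  shows "\<exists>xs. distinct xs \<and> 2 \<le> length xs \<and> hd xs = i \<and> last xs = j \<and> set xs \<subseteq> {..<n} \<and>
            (\<forall>l. Suc l < length xs \<longrightarrow> adjacent (\<kappa> (xs ! l)) (\<kappa> (xs ! Suc l))) \<and>
            (\<exists>c\<in>{fst (\<kappa> i), fst (\<kappa> j)}. \<exists>r\<in>{snd (\<kappa> i), snd (\<kappa> j)}.
               set xs \<subseteq> {i, j} \<union> relay ` {v. inner_cell q v \<and> (fst v = c \<or> snd v = r)})"
proof -
  \<comment> \<open>Taking the row of the endpoint with the smaller vertical extent keeps the corner inside the disk.\<close>
  obtain c r where c: "c \<in> {fst (\<kappa> i), fst (\<kappa> j)}" and r: "r \<in> {snd (\<kappa> i), snd (\<kappa> j)}"
    and corner: "inner_cell q (c, r)"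
    and on: "\<And>u. u \<in> {\<kappa> i, \<kappa> j} \<Longrightarrow> fst u = c \<or> snd u = r"
  proof (cases "extent (snd (\<kappa> i)) \<le> extent (snd (\<kappa> j))")
    case True
    then have "(extent (snd (\<kappa> i)))\<^sup>2 \<le> (extent (snd (\<kappa> j)))\<^sup>2"
      by (intro power_mono extent_nonneg)
    then have "inner_cell q (fst (\<kappa> j), snd (\<kappa> i))"
      using inner(2) by (auto simp: inner_cell_def)
    then show ?thesis by (intro that[of "fst (\<kappa> j)" "snd (\<kappa> i)"]) auto
  next
    case False
    then have "(extent (snd (\<kappa> j)))\<^sup>2 \<le> (extent (snd (\<kappa> i)))\<^sup>2"
      by (intro power_mono extent_nonneg) auto
    then have "inner_cell q (fst (\<kappa> i), snd (\<kappa> j))"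
      using inner(1) by (auto simp: inner_cell_def)
    then show ?thesis by (intro that[of "fst (\<kappa> i)" "snd (\<kappa> j)"]) auto
  qed
  define P where "P = {v. inner_cell q v \<and> (fst v = c \<or> snd v = r)}"
  define V where "V = {i, j} \<union> relay ` P"
  \<comment> \<open>Both ends are confined to \<open>V\<close>, so a path extracted from the closure
    still uses only the two endpoints and relays on the row and column of the corner.\<close>
  define E where "E a b \<longleftrightarrow> a \<in> V \<and> b \<in> V \<and> adjacent (\<kappa> a) (\<kappa> b)" for a b
  have sym: "symp E" by (auto simp: symp_def E_def adjacent_def)
  then have sym': "symp E\<^sup>*\<^sup>*" by (rule symp_rtranclp)
  have E_relay: "E (relay u) (relay v)" if "u \<in> P" "v \<in> P" "adjacent u v" for u v
    using that relay[of u] relay[of v] by (auto simp: E_def V_def P_def)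
  have between: "(extent y)\<^sup>2 \<le> max ((extent x)\<^sup>2) ((extent z)\<^sup>2)" if "x \<le> y" "y \<le> z" for x y z
  proof -
    have "(extent y)\<^sup>2 \<le> (max (extent x) (extent z))\<^sup>2"
      using that by (intro power_mono extent_between extent_nonneg)
    then show ?thesis by (auto simp: max_def split: if_splits)
  qed
  have row: "E\<^sup>*\<^sup>* (relay (x, r)) (relay (z, r))"
    if "(x, r) \<in> P" "(z, r) \<in> P" "x \<le> z" for x z
  proof (rule rtranclp_int_interval[where f = "\<lambda>y. relay (y, r)"])
    fix y assume y: "x \<le> y" "y < z"
    have "(y', r) \<in> P" if "x \<le> y'" "y' \<le> z" for y'
      using between[OF that] \<open>(x, r) \<in> P\<close> \<open>(z, r) \<in> P\<close> by (auto simp: P_def inner_cell_def)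
    then show "E (relay (y, r)) (relay (y + 1, r))" using y by (intro E_relay) (auto simp: adjacent_def)
  qed (use that in auto)
  have col: "E\<^sup>*\<^sup>* (relay (c, x)) (relay (c, z))"
    if "(c, x) \<in> P" "(c, z) \<in> P" "x \<le> z" for x z
  proof (rule rtranclp_int_interval[where f = "\<lambda>y. relay (c, y)"])
    fix y assume y: "x \<le> y" "y < z"
    have "(c, y') \<in> P" if "x \<le> y'" "y' \<le> z" for y'
      using between[OF that] \<open>(c, x) \<in> P\<close> \<open>(c, z) \<in> P\<close> by (auto simp: P_def inner_cell_def)
    then show "E (relay (c, y)) (relay (c, y + 1))" using y by (intro E_relay) (auto simp: adjacent_def)
  qed (use that in auto)
  have cornerP: "(c, r) \<in> P" using corner by (simp add: P_def)
  have to_corner: "E\<^sup>*\<^sup>* a (relay (c, r))" if a: "a \<in> {i, j}" for a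
  proof -
    have aP: "\<kappa> a \<in> P" using a inner on[of "\<kappa> a"] by (auto simp: P_def)
    \<comment> \<open>The relay is \<open>a\<close> itself or another node of the same cell;
      \<open>adjacent\<close> admits equal cells for this hop.\<close>
    have "E a (relay (\<kappa> a))"
      using a aP relay[of "\<kappa> a"] by (auto simp: E_def V_def P_def adjacent_def)
    moreover have "E\<^sup>*\<^sup>* (relay (\<kappa> a)) (relay (c, r))"
    proof (cases "snd (\<kappa> a) = r")
      case True
      then have eq: "\<kappa> a = (fst (\<kappa> a), r)" by (metis prod.collapse)
      show ?thesis
        using row[of "fst (\<kappa> a)" c] row[of c "fst (\<kappa> a)"] aP cornerP eq sympD[OF sym']
        by (cases "fst (\<kappa> a) \<le> c") auto
    next
      case False
      then have "fst (\<kappa> a) = c" using on a by blast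
      then have eq: "\<kappa> a = (c, snd (\<kappa> a))" by (metis prod.collapse)
      show ?thesis
        using col[of "snd (\<kappa> a)" r] col[of r "snd (\<kappa> a)"] aP cornerP eq sympD[OF sym']
        by (cases "snd (\<kappa> a) \<le> r") auto
    qed
    ultimately show ?thesis by (rule converse_rtranclp_into_rtranclp)
  qed
  have "E\<^sup>*\<^sup>* i j"
    using to_corner[of i] to_corner[of j] sympD[OF sym'] rtranclp_trans by (metis insertCI)
  then obtain ys0 where "rtrancl_path E i ys0 j"
    unfolding rtranclp_eq_rtrancl_path by blast
  then obtain ys where ys: "rtrancl_path E i ys j" "distinct (i # ys)"
    by (rule rtrancl_path_distinct)
  have ne: "ys \<noteq> []" using ys(1) ij(3) by (auto elim: rtrancl_path.cases)
  have step: "E ((i # ys) ! l) (ys ! l)" if "l < length ys" for l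
    using rtrancl_path_nth[OF ys(1) that] .
  have "set ys \<subseteq> V"
    using step by (metis E_def in_set_conv_nth subsetI)
  then have "set (i # ys) \<subseteq> V" by (simp add: V_def)
  moreover have "V \<subseteq> {..<n}" using ij relay by (auto simp: V_def P_def)
  moreover have "last (i # ys) = j" using rtrancl_path_last[OF ys(1) ne] ne by simp
  moreover have "adjacent (\<kappa> ((i # ys) ! l)) (\<kappa> ((i # ys) ! Suc l))" if "Suc l < length (i # ys)" for l
    using step[of l] that by (simp add: E_def)
  moreover have "2 \<le> length (i # ys)" using ne by (cases ys) auto
  ultimately show ?thesis
    using ys(2) c r unfolding V_def P_def
    by (intro exI[of _ "i # ys"] conjI bexI[of _ c] bexI[of _ r]) auto
qed

lemma card_UN_le_mult:
  assumes "finite I" "\<And>i. i \<in> I \<Longrightarrow> finite (A i) \<and> card (A i) \<le> m"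
  shows "card (\<Union>i\<in>I. A i) \<le> m * card I"
proof -
  have "card (\<Union>i\<in>I. A i) \<le> (\<Sum>i\<in>I. card (A i))" by (rule card_UN_le[OF assms(1)])
  also have "\<dots> \<le> (\<Sum>i\<in>I. m)" using assms by (intro sum_mono) auto
  finally show ?thesis by (simp add: mult.commute)
qed

text \<open>A pair transmits from cell \<open>v\<close> only if one of its endpoints lies in the
  column or row of \<open>v\<close>, and then only from \<open>i\<close>, \<open>d i\<close> or the
  relay of \<open>v\<close>. Four families of pairs, of sizes at most \<open>X\<close>,
  \<open>X\<close>, \<open>Y\<close>, \<open>Y\<close>, with three candidate nodes each give the
  load \<open>6 * (X + Y)\<close>.\<close>

lemma grid_system_exists:
  fixes pos :: "nat \<Rightarrow> point" and \<kappa> :: "nat \<Rightarrow> int \<times> int" and k :: nat and X Y :: nat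
  assumes "0 < n" and "0 < k" and dest: "is_dest_map n d"
    and occupied: "\<And>v. inner_cell q v \<Longrightarrow> \<exists>a<n. \<kappa> a = v"
    and inner: "\<And>a. a < n \<Longrightarrow> inner_cell q (\<kappa> a)"
    and near: "\<And>a b. a < n \<Longrightarrow> b < n \<Longrightarrow> adjacent (\<kappa> a) (\<kappa> b) \<Longrightarrow> norm (pos a - pos b) \<le> C"
    and far: "\<And>a b. a < n \<Longrightarrow> b < n \<Longrightarrow> \<kappa> a \<noteq> \<kappa> b \<Longrightarrow>
                fst (\<kappa> a) mod int k = fst (\<kappa> b) mod int k \<Longrightarrow>
                snd (\<kappa> a) mod int k = snd (\<kappa> b) mod int k \<Longrightarrow> C * (2 + D) \<le> norm (pos a - pos b)"
    and src: "\<And>v. inner_cell q v \<Longrightarrow> card {i. i < n \<and> fst (\<kappa> i) = fst v} \<le> X \<and> card {i. i < n \<and> snd (\<kappa> i) = snd v} \<le> X"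
    and dst: "\<And>v. inner_cell q v \<Longrightarrow> card {i. i < n \<and> fst (\<kappa> (d i)) = fst v} \<le> Y \<and> card {i. i < n \<and> snd (\<kappa> (d i)) = snd v} \<le> Y"
  shows "\<exists>S. is_system n d S \<and> successful (DC C D) n pos S \<and> period n S \<le> k * k * (6 * (X + Y))"
proof -
  obtain relay where relay: "\<And>v. inner_cell q v \<Longrightarrow> relay v < n \<and> \<kappa> (relay v) = v"
    using occupied by metis
  have d: "d i < n" "d i \<noteq> i" if "i < n" for i using dest that by (auto simp: is_dest_map_def)
  define good where "good i xs \<longleftrightarrow> distinct xs \<and> 2 \<le> length xs \<and> hd xs = i \<and> last xs = d i \<and> set xs \<subseteq> {..<n} \<and>
            (\<forall>l. Suc l < length xs \<longrightarrow> adjacent (\<kappa> (xs ! l)) (\<kappa> (xs ! Suc l))) \<and>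
            (\<exists>c\<in>{fst (\<kappa> i), fst (\<kappa> (d i))}. \<exists>r\<in>{snd (\<kappa> i), snd (\<kappa> (d i))}.
               set xs \<subseteq> {i, d i} \<union> relay ` {v. inner_cell q v \<and> (fst v = c \<or> snd v = r)})" for i xs
  have "\<exists>xs. good i xs" if "i < n" for i
    unfolding good_def
    by (rule route_exists[OF relay]) (use that d[of i] inner in auto)
  then obtain route where route: "\<And>i. i < n \<Longrightarrow> good i (route i)" by metis
  have load: "card (transmissions n route \<kappa> v) \<le> 6 * (X + Y)" for v
  proof (cases "transmissions n route \<kappa> v = {}")
    case False
    \<comment> \<open>A cell carrying a transmission contains a node, hence is inner, and the counts
      \<open>src\<close> and \<open>dst\<close> apply to it.\<close>
    then have v: "inner_cell q v"
      using route inner by (fastforce simp: transmissions_def good_def dest: in_set_butlastD)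
    define Z where "Z = {i. i < n \<and> fst (\<kappa> i) = fst v} \<union> {i. i < n \<and> snd (\<kappa> i) = snd v} \<union>
      {i. i < n \<and> fst (\<kappa> (d i)) = fst v} \<union> {i. i < n \<and> snd (\<kappa> (d i)) = snd v}"
    have "transmissions n route \<kappa> v \<subseteq> (\<Union>i\<in>Z. {(i, i), (i, d i), (i, relay v)})"
    proof
      fix x assume "x \<in> transmissions n route \<kappa> v"
      then obtain i a where x: "x = (i, a)" and i: "i < n" and a: "a \<in> set (butlast (route i))"
        and v: "v = \<kappa> a"
        by (auto simp: transmissions_def)
      obtain c r where c: "c \<in> {fst (\<kappa> i), fst (\<kappa> (d i))}" and r: "r \<in> {snd (\<kappa> i), snd (\<kappa> (d i))}"
        and sub: "set (route i) \<subseteq> {i, d i} \<union> relay ` {v. inner_cell q v \<and> (fst v = c \<or> snd v = r)}"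
        using route[OF i] unfolding good_def by blast
      from a have "a \<in> set (route i)" by (rule in_set_butlastD)
      with sub consider "a = i" | "a = d i" | w where "a = relay w" "inner_cell q w" "fst w = c \<or> snd w = r"
        by blast
      then have "i \<in> Z \<and> (a = i \<or> a = d i \<or> a = relay v)"
        using i v c r relay by cases (auto simp: Z_def)
      then show "x \<in> (\<Union>i\<in>Z. {(i, i), (i, d i), (i, relay v)})" using x by auto
    qed
    then have "card (transmissions n route \<kappa> v) \<le> card (\<Union>i\<in>Z. {(i, i), (i, d i), (i, relay v)})"
      by (intro card_mono) (auto simp: Z_def)
    also have "\<dots> \<le> 3 * card Z"
      by (intro card_UN_le_mult) (auto simp: Z_def card_insert_if)
    also have "3 * card Z \<le> 3 * (X + X + Y + Y)"
      unfolding Z_def using src[OF v] dst[OF v]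
      by (intro mult_le_mono2 order_trans[OF card_Un_le] add_mono) auto
    finally show ?thesis by simp
  qed simp
  show ?thesis
  proof (rule schedule_exists[OF \<open>0 < n\<close> \<open>0 < k\<close> _ _ load far])
    fix i j assume "i < n" "Suc j < length (route i)"
    then show "norm (pos (route i ! j) - pos (route i ! Suc j)) \<le> C"
      using route[of i] by (intro near) (auto simp: good_def subset_iff)
  qed (use route in \<open>auto simp: good_def\<close>)
qed

section \<open>Assigning points of the disk to cells\<close>

definition cell :: "real \<Rightarrow> point \<Rightarrow> int \<times> int" where
  "cell h x = (\<lfloor>x $ 1 / h\<rfloor>, \<lfloor>x $ 2 / h\<rfloor>)"

text \<open>Cells meeting the boundary of the disk may have tiny area, so their points are first moved
  towards the centre by at most \<open>3 h / 2\<close>, which exceeds the diagonal of a cell.\<close>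
definition anchor :: "real \<Rightarrow> real \<Rightarrow> point \<Rightarrow> point" where
  "anchor R h x = (if inner_cell (R / h) (cell h x) then x else (1 - 3 * h / (2 * R)) *\<^sub>R x)"

definition home :: "real \<Rightarrow> real \<Rightarrow> point \<Rightarrow> int \<times> int" where
  "home R h x = cell h (anchor R h x)"

section \<open>Displacement, range and separation of points in terms of their home cells\<close>

lemma norm_point: "(norm (x::point))\<^sup>2 = (x $ 1)\<^sup>2 + (x $ 2)\<^sup>2"
  by (simp add: norm_vec_def L2_set_def sum_2)

lemma extent_floor_le: "extent \<lfloor>t\<rfloor> \<le> \<bar>t\<bar> + 1"
  unfolding extent_def by linarith

text \<open>Each extent exceeds the absolute coordinate, in units of \<open>h\<close>, by at most 1.
  With \<open>u + v \<le> 3 / 2 * w\<close>, where 3/2 is a rational substitute for the square root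
  of 2, completing the square absorbs both units into the margin \<open>3 * h / 2\<close>.\<close>

lemma inner_cell_cell:
  assumes "0 < h" "norm x \<le> R - 3 * h / 2"
  shows "inner_cell (R / h) (cell h x)"
proof -
  define u v w where "u = \<bar>x $ 1 / h\<bar>" and "v = \<bar>x $ 2 / h\<bar>" and "w = norm x / h"
  have nn: "0 \<le> u" "0 \<le> v" "0 \<le> w" using assms(1) by (auto simp: u_def v_def w_def)
  have w2: "w\<^sup>2 = u\<^sup>2 + v\<^sup>2"
    unfolding u_def v_def w_def by (simp add: power_divide norm_point add_divide_distrib)
  have "(u + v)\<^sup>2 \<le> (3 / 2 * w)\<^sup>2"
  proof -
    have "0 \<le> (u - v)\<^sup>2" by simp
    then have "(u + v)\<^sup>2 \<le> 2 * w\<^sup>2" unfolding w2 by (simp add: power2_eq_square algebra_simps)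
    also have "\<dots> \<le> (3 / 2 * w)\<^sup>2" by (simp add: power_mult_distrib power2_eq_square)
    finally show ?thesis .
  qed
  then have uv: "u + v \<le> 3 / 2 * w"
    by (rule power2_le_imp_le) (use nn in auto)
  have "(extent (fst (cell h x)))\<^sup>2 + (extent (snd (cell h x)))\<^sup>2 \<le> (u + 1)\<^sup>2 + (v + 1)\<^sup>2"
    unfolding cell_def u_def v_def fst_conv snd_conv
    by (intro add_mono power_mono extent_floor_le extent_nonneg)
  also have "\<dots> = w\<^sup>2 + 2 * (u + v) + 2" unfolding w2 by (simp add: power2_eq_square algebra_simps)
  also have "\<dots> \<le> (w + 3 / 2)\<^sup>2" using uv by (simp add: power2_eq_square algebra_simps)
  also have "\<dots> \<le> (R / h)\<^sup>2"
  proof (rule power_mono)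
    have "w + 3 / 2 = (norm x + 3 * h / 2) / h" using assms(1) by (simp add: w_def add_divide_distrib)
    also have "\<dots> \<le> R / h" using assms by (intro divide_right_mono) auto
    finally show "w + 3 / 2 \<le> R / h" .
  qed (use nn in auto)
  finally show ?thesis by (simp add: inner_cell_def)
qed

text \<open>The bound \<open>3 * h \<le> R\<close> makes the contraction factor at least 1/2. A
  contracted point ends at distance at most \<open>R - 3 * h / 2\<close> from the centre, where the
  cell of every point is inner.\<close>

lemma inner_cell_home:
  assumes "0 < h" "3 * h \<le> R" "norm x \<le> R"
  shows "inner_cell (R / h) (home R h x)"
proof (cases "inner_cell (R / h) (cell h x)")
  case True
  then show ?thesis by (simp add: home_def anchor_def)
next
  case False
  have pos: "0 \<le> 1 - 3 * h / (2 * R)" using assms by (auto simp: field_simps)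
  have "norm ((1 - 3 * h / (2 * R)) *\<^sub>R x) = (1 - 3 * h / (2 * R)) * norm x"
    using pos by simp
  also have "\<dots> \<le> (1 - 3 * h / (2 * R)) * R" using pos assms by (intro mult_left_mono) auto
  also have "\<dots> = R - 3 * h / 2" using assms by (auto simp: field_simps)
  finally show ?thesis using inner_cell_cell[OF assms(1)] False by (simp add: home_def anchor_def)
qed

lemma dist_anchor:
  assumes "0 < h" "0 < R" "norm x \<le> R"
  shows "norm (x - anchor R h x) \<le> 3 * h / 2"
proof (cases "inner_cell (R / h) (cell h x)")
  case True
  then show ?thesis using assms by (simp add: anchor_def)
next
  case False
  have "x - (1 - 3 * h / (2 * R)) *\<^sub>R x = (3 * h / (2 * R)) *\<^sub>R x"
    by (simp add: algebra_simps)
  then have "norm (x - anchor R h x) = 3 * h / (2 * R) * norm x"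
    using False assms by (simp add: anchor_def)
  also have "\<dots> \<le> 3 * h / (2 * R) * R" using assms by (intro mult_left_mono) auto
  also have "\<dots> = 3 * h / 2" using assms by simp
  finally show ?thesis .
qed

lemma floor_divide_diff:
  fixes s t h :: real
  assumes "0 < h"
  shows "\<bar>s - t\<bar> \<le> (of_int \<bar>\<lfloor>s / h\<rfloor> - \<lfloor>t / h\<rfloor>\<bar> + 1) * h"
    and "(of_int \<bar>\<lfloor>s / h\<rfloor> - \<lfloor>t / h\<rfloor>\<bar> - 1) * h \<le> \<bar>s - t\<bar>"
proof -
  have eq: "\<bar>s - t\<bar> = \<bar>s / h - t / h\<bar> * h"
    using assms by (simp add: abs_mult[symmetric] diff_divide_distrib[symmetric] abs_divide)
  have "\<bar>s / h - t / h\<bar> \<le> of_int \<bar>\<lfloor>s / h\<rfloor> - \<lfloor>t / h\<rfloor>\<bar> + 1"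
    by linarith
  then show "\<bar>s - t\<bar> \<le> (of_int \<bar>\<lfloor>s / h\<rfloor> - \<lfloor>t / h\<rfloor>\<bar> + 1) * h"
    unfolding eq using assms by (intro mult_right_mono) auto
  have "of_int \<bar>\<lfloor>s / h\<rfloor> - \<lfloor>t / h\<rfloor>\<bar> - 1 \<le> \<bar>s / h - t / h\<bar>"
    by linarith
  then show "(of_int \<bar>\<lfloor>s / h\<rfloor> - \<lfloor>t / h\<rfloor>\<bar> - 1) * h \<le> \<bar>s - t\<bar>"
    unfolding eq using assms by (intro mult_right_mono) auto
qed

text \<open>Two displacements of at most \<open>3 * h / 2\<close> and at most
  \<open>9 / 4 * h\<close> between the anchors add up to \<open>21 / 4 * h\<close>. This is the
  origin of the choice \<open>C = 6 * h\<close>.\<close>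

lemma adjacent_home_imp_near:
  assumes "0 < h" "0 < R" "norm x \<le> R" "norm y \<le> R" "adjacent (home R h x) (home R h y)"
  shows "norm (x - y) \<le> 6 * h"
proof -
  define a b where "a = anchor R h x" and "b = anchor R h y"
  define m m' where "m = \<bar>\<lfloor>a $ 1 / h\<rfloor> - \<lfloor>b $ 1 / h\<rfloor>\<bar>" and "m' = \<bar>\<lfloor>a $ 2 / h\<rfloor> - \<lfloor>b $ 2 / h\<rfloor>\<bar>"
  have "m + m' \<le> 1" "0 \<le> m" "0 \<le> m'"
    using assms(5) by (auto simp: adjacent_def home_def cell_def a_def b_def m_def m'_def)
  then have mm: "(m = 0 \<and> m' = 0) \<or> (m = 0 \<and> m' = 1) \<or> (m = 1 \<and> m' = 0)" by linarith
  have "(norm (a - b))\<^sup>2 = \<bar>a $ 1 - b $ 1\<bar>\<^sup>2 + \<bar>a $ 2 - b $ 2\<bar>\<^sup>2"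
    by (simp add: norm_point)
  also have "\<dots> \<le> ((of_int m + 1) * h)\<^sup>2 + ((of_int m' + 1) * h)\<^sup>2"
    unfolding m_def m'_def by (intro add_mono power_mono floor_divide_diff assms) auto
  \<comment> \<open>In the extreme case one index agrees and the other differs by 1, which gives
    \<open>h\<^sup>2 + (2 * h)\<^sup>2 = 5 * h\<^sup>2\<close>, and 5 is below 81/16.\<close>
  also have "\<dots> \<le> (9 / 4 * h)\<^sup>2"
    using mm by (auto simp: power_mult_distrib power2_eq_square)
  finally have ab: "norm (a - b) \<le> 9 / 4 * h"
    by (rule power2_le_imp_le) (use assms in auto)
  have "norm (x - y) = norm ((x - a) + (a - b) + (b - y))" by simp
  also have "\<dots> \<le> norm (x - a) + norm (a - b) + norm (b - y)"
    by (intro norm_triangle_le add_mono norm_triangle_ineq order_refl)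
  also have "norm (x - a) \<le> 3 * h / 2" unfolding a_def using assms by (intro dist_anchor) auto
  also note ab
  also have "norm (b - y) \<le> 3 * h / 2"
    unfolding b_def using dist_anchor[of h R y] assms by (auto simp: norm_minus_commute)
  finally show ?thesis using assms by simp
qed

lemma mod_eq_imp_far:
  fixes a b k :: int
  assumes "a \<noteq> b" "a mod k = b mod k"
  shows "k \<le> \<bar>a - b\<bar>"
proof -
  have "k dvd a - b" using assms(2) by (simp add: mod_eq_dvd_iff)
  then show ?thesis using assms(1) dvd_imp_le_int[of "a - b" k] by auto
qed

text \<open>Some cell index differs by at least \<open>k\<close>. Of the 4 subtracted, one pays for
  rounding to cells and three for moving both points by up to \<open>3 * h / 2\<close>.\<close>

lemma same_colour_home_imp_far:
  fixes k :: nat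
  assumes "0 < h" "0 < R" "norm x \<le> R" "norm y \<le> R" "home R h x \<noteq> home R h y"
    and "fst (home R h x) mod int k = fst (home R h y) mod int k"
    and "snd (home R h x) mod int k = snd (home R h y) mod int k"
  shows "(real k - 4) * h \<le> norm (x - y)"
proof -
  define a b where "a = anchor R h x" and "b = anchor R h y"
  have "\<exists>i::2. int k \<le> \<bar>\<lfloor>a $ i / h\<rfloor> - \<lfloor>b $ i / h\<rfloor>\<bar>"
    using assms(5-7) mod_eq_imp_far[of _ _ "int k"]
    by (auto simp: home_def cell_def a_def b_def)
  then obtain i :: 2 where i: "int k \<le> \<bar>\<lfloor>a $ i / h\<rfloor> - \<lfloor>b $ i / h\<rfloor>\<bar>" by blast
  have "real k \<le> of_int \<bar>\<lfloor>a $ i / h\<rfloor> - \<lfloor>b $ i / h\<rfloor>\<bar>" using i by linarith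
  then have "(real k - 1) * h \<le> (of_int \<bar>\<lfloor>a $ i / h\<rfloor> - \<lfloor>b $ i / h\<rfloor>\<bar> - 1) * h"
    using assms(1) by (intro mult_right_mono) auto
  also have "\<dots> \<le> \<bar>a $ i - b $ i\<bar>" by (rule floor_divide_diff[OF assms(1)])
  also have "\<dots> \<le> norm (a - b)" using component_le_norm_cart[of "a - b" i] by simp
  also have "a - b = (x - y) - (x - a) + (y - b)" by simp
  also have "norm \<dots> \<le> norm (x - y) + norm (x - a) + norm (y - b)"
    by (intro norm_triangle_le add_mono norm_triangle_ineq4 order_refl)
  also have "norm (x - a) \<le> 3 * h / 2" unfolding a_def using assms by (intro dist_anchor) auto
  also have "norm (y - b) \<le> 3 * h / 2" unfolding b_def using assms by (intro dist_anchor) auto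
  finally show ?thesis by (simp add: algebra_simps)
qed

section \<open>Areas of the regions assigned to a row, a column or a cell\<close>

lemma measure_cball_strip:
  fixes R lo hi :: real and b :: 2
  assumes "0 \<le> R" "lo \<le> hi"
  shows "cball 0 R \<inter> {x::point. lo \<le> x $ b \<and> x $ b \<le> hi} \<in> sets lborel"
    and "measure lborel (cball 0 R \<inter> {x::point. lo \<le> x $ b \<and> x $ b \<le> hi}) \<le> 2 * R * (hi - lo)"
proof -
  let ?l = "(\<chi> i. if i = b then lo else -R) :: point" and ?u = "(\<chi> i. if i = b then hi else R) :: point"
  have "closed (cball 0 R \<inter> {x::point. lo \<le> x $ b \<and> x $ b \<le> hi})"
    by (intro closed_Int closed_cball closed_Collect_conj closed_Collect_le continuous_intros)
  then show m: "cball 0 R \<inter> {x::point. lo \<le> x $ b \<and> x $ b \<le> hi} \<in> sets lborel"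
    by simp
  have "measure lborel (cball 0 R \<inter> {x::point. lo \<le> x $ b \<and> x $ b \<le> hi}) \<le> measure lborel (cbox ?l ?u)"
  proof (rule measure_mono_fmeasurable[OF _ m])
    show "cball 0 R \<inter> {x::point. lo \<le> x $ b \<and> x $ b \<le> hi} \<subseteq> cbox ?l ?u"
    proof
      fix x :: point assume x: "x \<in> cball 0 R \<inter> {x. lo \<le> x $ b \<and> x $ b \<le> hi}"
      have "\<bar>x $ i\<bar> \<le> R" for i using component_le_norm_cart[of x i] x by auto
      then show "x \<in> cbox ?l ?u" using x by (auto simp: mem_box_cart abs_le_iff minus_le_iff)
    qed
  qed simp
  also have "\<dots> = (\<Prod>i\<in>UNIV. ?u $ i - ?l $ i)"
    using assms by (intro content_cbox_cart) (auto simp: interval_ne_empty_cart)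
  also have "\<dots> = 2 * R * (hi - lo)"
    using exhaust_2[of b] by (auto simp: UNIV_2)
  finally show "measure lborel (cball 0 R \<inter> {x::point. lo \<le> x $ b \<and> x $ b \<le> hi}) \<le> 2 * R * (hi - lo)" .
qed

lemma measurable_extent_floor [measurable]:
  "(\<lambda>x::point. extent \<lfloor>x $ b / h\<rfloor>) \<in> borel_measurable borel"
proof -
  have "(\<lambda>x::point. x $ b / h) \<in> borel_measurable borel"
    by (intro borel_measurable_divide borel_measurable_const borel_measurable_continuous_onI continuous_intros)
  then have "(\<lambda>x::point. \<lfloor>x $ b / h\<rfloor>) \<in> borel \<rightarrow>\<^sub>M count_space UNIV"
    by measurable
  then show ?thesis by (rule measurable_compose) simp
qed

lemma measurable_anchor [measurable]: "anchor R h \<in> borel_measurable borel"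
  unfolding anchor_def inner_cell_def cell_def fst_conv snd_conv by measurable

text \<open>The coordinate index \<open>b\<close> allows rows and columns to be handled by the same
  statements.\<close>

definition home_coord :: "real \<Rightarrow> real \<Rightarrow> 2 \<Rightarrow> point \<Rightarrow> int" where
  "home_coord R h b x = \<lfloor>anchor R h x $ b / h\<rfloor>"

lemma home_eq_coords: "home R h x = (home_coord R h 1 x, home_coord R h 2 x)"
  by (simp add: home_def cell_def home_coord_def)

lemma measurable_home_coord [measurable]:
  "home_coord R h b \<in> borel \<rightarrow>\<^sub>M count_space UNIV"
proof -
  have "(\<lambda>x::point. x $ b / h) \<in> borel_measurable borel"
    by (intro borel_measurable_divide borel_measurable_const borel_measurable_continuous_onI continuous_intros)
  from measurable_compose[OF measurable_anchor this]
  show ?thesis unfolding home_coord_def by measurable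
qed

text \<open>A point counted here lies in the strip itself (\<open>A\<close>), or the contraction by
  \<open>\<delta>\<close> carries it into the strip, so that it lies in the strip dilated by
  \<open>1 / \<delta> \<le> 2\<close> (\<open>B\<close>). The widths \<open>h\<close> and at most
  \<open>2 * h\<close>, times the length \<open>2 * R\<close>, add up to
  \<open>6 * R * h\<close>.\<close>

lemma measure_home_strip:
  assumes "0 < h" "3 * h \<le> R"
  shows "measure lborel (cball 0 R \<inter> {x. home_coord R h b x = r}) \<le> 6 * R * h"
proof -
  define \<delta> where "\<delta> = 1 - 3 * h / (2 * R)"
  have \<delta>: "1 / 2 \<le> \<delta>" using assms by (auto simp: \<delta>_def field_simps)
  define A where "A = cball 0 R \<inter> {x::point. of_int r * h \<le> x $ b \<and> x $ b \<le> (of_int r + 1) * h}"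
  define B where "B = cball 0 R \<inter> {x::point. of_int r * h / \<delta> \<le> x $ b \<and> x $ b \<le> (of_int r + 1) * h / \<delta>}"
  have AB: "A \<in> sets lborel" "B \<in> sets lborel"
    unfolding A_def B_def using assms \<delta>
    by (intro measure_cball_strip; auto simp: divide_right_mono mult_right_mono)+
  have fin: "A \<in> fmeasurable lborel" "B \<in> fmeasurable lborel"
    using AB by (auto intro!: fmeasurableI2[OF fmeasurable_compact[OF compact_cball[of 0 R]]] simp: A_def B_def)
  have "measure lborel (cball 0 R \<inter> {x. home_coord R h b x = r}) \<le> measure lborel (A \<union> B)"
  proof (rule measure_mono_fmeasurable)
    show "cball 0 R \<inter> {x. home_coord R h b x = r} \<subseteq> A \<union> B"
    proof
      fix x assume x: "x \<in> cball 0 R \<inter> {x. home_coord R h b x = r}"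
      then have "of_int r \<le> anchor R h x $ b / h \<and> anchor R h x $ b / h < of_int r + 1"
        by (auto simp: floor_eq_iff home_coord_def)
      then have *: "of_int r * h \<le> anchor R h x $ b" "anchor R h x $ b \<le> (of_int r + 1) * h"
        using assms by (auto simp: field_simps)
      show "x \<in> A \<union> B"
      proof (cases "inner_cell (R / h) (cell h x)")
        case True
        then show ?thesis using * x by (auto simp: A_def anchor_def)
      next
        case False
        then have "of_int r * h \<le> \<delta> * x $ b" "\<delta> * x $ b \<le> (of_int r + 1) * h"
          using * by (auto simp: anchor_def \<delta>_def)
        then have "x \<in> B" using x \<delta> by (auto simp: B_def field_simps)
        then show ?thesis by simp
      qed
    qed
    have "{x. home_coord R h b x = r} \<in> sets borel"
      by measurable
    then show "cball 0 R \<inter> {x. home_coord R h b x = r} \<in> sets lborel" by auto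
  qed (use fin in auto)
  also have "\<dots> \<le> measure lborel A + measure lborel B"
    using fin by (intro measure_Un_le) auto
  also have "measure lborel A \<le> 2 * R * ((of_int r + 1) * h - of_int r * h)"
    unfolding A_def using assms by (intro measure_cball_strip) (auto intro!: mult_right_mono)
  also have "measure lborel B \<le> 2 * R * ((of_int r + 1) * h / \<delta> - of_int r * h / \<delta>)"
    unfolding B_def using assms \<delta>
    by (intro measure_cball_strip) (auto intro!: mult_right_mono divide_right_mono)
  also have "(of_int r + 1) * h - of_int r * h = h" by (simp add: algebra_simps)
  also have "(of_int r + 1) * h / \<delta> - of_int r * h / \<delta> = h / \<delta>"
    by (simp add: diff_divide_distrib[symmetric] algebra_simps)
  also have "2 * R * h + 2 * R * (h / \<delta>) \<le> 2 * R * h + 2 * R * (2 * h)"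
  proof -
    have "h / \<delta> \<le> h / (1 / 2)" using \<delta> assms by (intro divide_left_mono) auto
    then show ?thesis using assms by (intro add_mono mult_left_mono) auto
  qed
  finally show ?thesis by simp
qed

lemma abs_le_extent:
  assumes "of_int c * h < t" "t < (of_int c + 1) * h" "0 < h"
  shows "\<bar>t\<bar> \<le> extent c * h"
proof -
  have "of_int c < t / h" "t / h < of_int c + 1" using assms by (auto simp: field_simps)
  then have "\<bar>t / h\<bar> \<le> extent c" unfolding extent_def by linarith
  then show ?thesis using assms(3) by (simp add: field_simps)
qed

text \<open>The open square of an inner cell lies in the disk, and its points are their own anchors.
  Points moved in from the boundary only enlarge the set.\<close>

lemma measure_home_cell:
  assumes "0 < h" "0 < R" "inner_cell (R / h) v"
  shows "h\<^sup>2 \<le> measure lborel (cball 0 R \<inter> {x. home R h x = v})"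
proof -
  let ?c = "\<lambda>i::2. real_of_int (if i = 1 then fst v else snd v)"
  let ?l = "(\<chi> i. ?c i * h) :: point" and ?u = "(\<chi> i. (?c i + 1) * h) :: point"
  have sub: "box ?l ?u \<subseteq> cball 0 R \<inter> {x. home R h x = v}"
  proof
    fix x assume "x \<in> box ?l ?u"
    then have x: "of_int (fst v) * h < x $ 1" "x $ 1 < (of_int (fst v) + 1) * h"
      "of_int (snd v) * h < x $ 2" "x $ 2 < (of_int (snd v) + 1) * h"
      by (auto simp: mem_box_cart forall_2)
    have "of_int (fst v) < x $ 1 / h" "x $ 1 / h < of_int (fst v) + 1"
      "of_int (snd v) < x $ 2 / h" "x $ 2 / h < of_int (snd v) + 1"
      using x assms(1) by (auto simp: field_simps)
    then have c: "cell h x = v" unfolding cell_def by (intro prod_eqI) (auto simp: floor_eq_iff)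
    have "(norm x)\<^sup>2 = \<bar>x $ 1\<bar>\<^sup>2 + \<bar>x $ 2\<bar>\<^sup>2" by (simp add: norm_point)
    also have "\<dots> \<le> (extent (fst v) * h)\<^sup>2 + (extent (snd v) * h)\<^sup>2"
      using x assms(1) by (intro add_mono power_mono abs_le_extent) auto
    also have "\<dots> = ((extent (fst v))\<^sup>2 + (extent (snd v))\<^sup>2) * h\<^sup>2"
      by (simp add: power_mult_distrib algebra_simps)
    also have "\<dots> \<le> (R / h)\<^sup>2 * h\<^sup>2"
      using assms(3) unfolding inner_cell_def by (intro mult_right_mono) auto
    also have "\<dots> = R\<^sup>2" using assms(1) by (simp add: power_divide)
    finally have "norm x \<le> R" by (rule power2_le_imp_le) (use assms in auto)
    then show "x \<in> cball 0 R \<inter> {x. home R h x = v}"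
      using c assms(3) by (auto simp: home_def anchor_def)
  qed
  have "h\<^sup>2 = (\<Prod>i\<in>UNIV. ?u $ i - ?l $ i)"
    by (simp add: UNIV_2 algebra_simps power2_eq_square)
  also have "\<dots> = measure lborel (cbox ?l ?u)"
    using assms(1) by (intro content_cbox_cart[symmetric]) (auto simp: interval_ne_empty_cart mult_right_mono)
  also have "\<dots> = measure lborel (box ?l ?u)"
    by (simp add: measure_lborel_box_eq measure_lborel_cbox_eq)
  also have "\<dots> \<le> measure lborel (cball 0 R \<inter> {x. home R h x = v})"
  proof (rule measure_mono_fmeasurable[OF sub])
    have "{x. home R h x = v} = {x. home_coord R h 1 x = fst v} \<inter> {x. home_coord R h 2 x = snd v}"
      by (auto simp: home_eq_coords)
    also have "\<dots> \<in> sets borel" by measurable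
    finally show "cball 0 R \<inter> {x. home R h x = v} \<in> fmeasurable lborel"
      by (intro fmeasurableI2[OF fmeasurable_compact[OF compact_cball[of 0 R]]]) auto
  qed simp
  finally show ?thesis .
qed

section \<open>Occupancy of random nodes\<close>

lemma real_card_eq_sum_indicator:
  assumes "finite I"
  shows "real (card {i \<in> I. P i}) = (\<Sum>i\<in>I. if P i then 1 else 0)"
  using assms by (simp add: sum.If_cases Int_def)

lemma borel_measurable_card_Collect [measurable (raw)]:
  assumes "finite I" "\<And>i. i \<in> I \<Longrightarrow> Measurable.pred M (P i)"
  shows "(\<lambda>x. real (card {i \<in> I. P i x})) \<in> borel_measurable M"
  unfolding real_card_eq_sum_indicator[OF assms(1)]
  by (intro borel_measurable_sum measurable_If) (use assms(2) in \<open>auto simp: pred_def\<close>)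

lemma pred_PiM_component:
  assumes "i \<in> I" "A \<in> sets (M i)"
  shows "Measurable.pred (PiM I M) (\<lambda>x. x i \<in> A)"
  by (rule pred_sets2[where N = "M i"]) (use assms in auto)

text \<open>Markov's inequality for the exponential of the count.\<close>
lemma PiM_count_tail:
  assumes "finite I" and prob: "\<And>i. prob_space (M i)"
    and A: "\<And>i. i \<in> I \<Longrightarrow> A i \<in> sets (M i)"
    and p: "\<And>i. i \<in> I \<Longrightarrow> measure (M i) (A i) \<le> p"
  shows "measure (PiM I M) {x \<in> space (PiM I M). t < real (card {i \<in> I. x i \<in> A i})}
           \<le> exp (2 * p * card I - t)"
proof -
  interpret product_prob_space M I
    by (rule product_prob_spaceI) (rule prob)
  let ?S = "{x \<in> space (PiM I M). t < real (card {i \<in> I. x i \<in> A i})}"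
  have [measurable]: "(\<lambda>x. real (card {i \<in> I. x i \<in> A i})) \<in> borel_measurable (PiM I M)"
    using assms(1) A by (intro borel_measurable_card_Collect pred_PiM_component)
  have S: "?S \<in> sets (PiM I M)" by measurable
  \<comment> \<open>The product of the \<open>f i (x i)\<close> is exp of the count, and
    independence turns its integral into a product of integrals, each at most
    \<open>1 + (exp 1 - 1) * p \<le> 1 + 2 * p\<close>.\<close>
  define f where "f i y = ennreal (if y \<in> A i then exp 1 else 1)" for i y
  have f_meas: "f i \<in> borel_measurable (M i)" if "i \<in> I" for i
    unfolding f_def using A[OF that] by measurable
  have f_int: "(\<integral>\<^sup>+y. f i y \<partial>M i) \<le> ennreal (exp (2 * p))" if "i \<in> I" for i
  proof -
    have "ennreal (exp 1) = 1 + ennreal (exp 1 - 1)"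
      using ennreal_plus[of 1 "exp 1 - 1"] by simp
    then have "(\<integral>\<^sup>+y. f i y \<partial>M i) = (\<integral>\<^sup>+y. 1 + ennreal (exp 1 - 1) * indicator (A i) y \<partial>M i)"
      by (intro nn_integral_cong) (auto simp: f_def indicator_def)
    also have "\<dots> = 1 + ennreal (exp 1 - 1) * emeasure (M i) (A i)"
      using A[OF that] by (simp add: nn_integral_add nn_integral_cmult M.emeasure_space_1)
    also have "\<dots> = ennreal (1 + (exp 1 - 1) * measure (M i) (A i))"
      by (simp add: M.emeasure_eq_measure ennreal_mult)
    also have "\<dots> \<le> ennreal (exp (2 * p))"
    proof (rule ennreal_leI)
      have "(exp 1 - 1) * measure (M i) (A i) \<le> 2 * p"
        using exp_le p[OF that] by (intro mult_mono) auto
      then show "1 + (exp 1 - 1) * measure (M i) (A i) \<le> exp (2 * p)"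
        using exp_ge_add_one_self[of "2 * p"] by linarith
    qed
    finally show ?thesis .
  qed
  have "emeasure (PiM I M) ?S = (\<integral>\<^sup>+x. indicator ?S x \<partial>PiM I M)"
    using S by simp
  also have "\<dots> \<le> (\<integral>\<^sup>+x. ennreal (exp (- t)) * (\<Prod>i\<in>I. f i (x i)) \<partial>PiM I M)"
  proof (rule nn_integral_mono)
    fix x assume "x \<in> space (PiM I M)"
    have "(\<Prod>i\<in>I. f i (x i)) = ennreal (\<Prod>i\<in>I. if x i \<in> A i then exp 1 else 1)"
      unfolding f_def by (rule prod_ennreal) auto
    also have "(\<Prod>i\<in>I. if x i \<in> A i then exp 1 else 1) = exp (real (card {i \<in> I. x i \<in> A i}))"
      using assms(1) by (simp add: prod.If_cases Int_def exp_of_nat_mult[symmetric])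
    finally have eq: "ennreal (exp (- t)) * (\<Prod>i\<in>I. f i (x i)) =
        ennreal (exp (real (card {i \<in> I. x i \<in> A i}) - t))"
      by (simp add: ennreal_mult[symmetric] exp_add[symmetric])
    show "indicator ?S x \<le> ennreal (exp (- t)) * (\<Prod>i\<in>I. f i (x i))"
      unfolding eq by (auto simp: indicator_def)
  qed
  also have "\<dots> = ennreal (exp (- t)) * (\<integral>\<^sup>+x. (\<Prod>i\<in>I. f i (x i)) \<partial>PiM I M)"
    using f_meas by (intro nn_integral_cmult borel_measurable_prod_ennreal)
      (auto intro: measurable_compose[OF measurable_component_singleton])
  also have "(\<integral>\<^sup>+x. (\<Prod>i\<in>I. f i (x i)) \<partial>PiM I M) = (\<Prod>i\<in>I. \<integral>\<^sup>+y. f i y \<partial>M i)"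
    using assms(1) f_meas by (rule product_nn_integral_prod)
  also have "\<dots> \<le> (\<Prod>i\<in>I. ennreal (exp (2 * p)))"
    using f_int by (rule prod_mono_ennreal)
  also have "ennreal (exp (- t)) * (\<Prod>i\<in>I. ennreal (exp (2 * p))) = ennreal (exp (2 * p * card I - t))"
    by (simp add: ennreal_power ennreal_mult[symmetric] exp_of_nat_mult[symmetric] exp_add[symmetric] mult_ac)
  finally have "emeasure (PiM I M) ?S \<le> ennreal (exp (2 * p * card I - t))"
    by (simp add: mult_left_mono)
  then show ?thesis by (simp add: emeasure_eq_measure)
qed

text \<open>Independence gives a product of factors \<open>1 - measure (M i) (A i)\<close>, each at
  most \<open>exp (- p)\<close>. For a fixed inner cell this bounds the chance that the cell stays
  empty.\<close>

lemma PiM_avoid_prob: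
  assumes "finite I" and prob: "\<And>i. prob_space (M i)"
    and A: "\<And>i. i \<in> I \<Longrightarrow> A i \<in> sets (M i)"
    and p: "\<And>i. i \<in> I \<Longrightarrow> p \<le> measure (M i) (A i)"
  shows "measure (PiM I M) {x \<in> space (PiM I M). \<forall>i\<in>I. x i \<notin> A i} \<le> exp (- p * card I)"
proof -
  interpret product_prob_space M I
    by (rule product_prob_spaceI) (rule prob)
  have "{x \<in> space (PiM I M). \<forall>i\<in>I. x i \<notin> A i} = {x \<in> space (PiM I M). \<forall>i\<in>I. x i \<in> space (M i) - A i}"
    by (auto simp: space_PiM)
  also have "emeasure (PiM I M) \<dots> = (\<Prod>i\<in>I. emeasure (M i) (space (M i) - A i))"
    using assms(1) A by (intro emeasure_PiM_Collect) auto
  also have "\<dots> \<le> (\<Prod>i\<in>I. ennreal (exp (- p)))"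
  proof (rule prod_mono_ennreal)
    fix i assume i: "i \<in> I"
    have "measure (M i) (space (M i) - A i) = 1 - measure (M i) (A i)"
      using A[OF i] by (rule M.prob_compl)
    also have "\<dots> \<le> exp (- p)" using p[OF i] exp_ge_add_one_self[of "- p"] by linarith
    finally show "emeasure (M i) (space (M i) - A i) \<le> ennreal (exp (- p))"
      by (simp add: M.emeasure_eq_measure ennreal_leI)
  qed
  also have "\<dots> = ennreal (exp (- p * card I))"
    by (simp add: ennreal_power exp_of_nat_mult[symmetric] mult_ac)
  finally show ?thesis by (simp add: emeasure_eq_measure)
qed

text \<open>Conditioning on the first component: positions will be drawn first, and for every good
  choice of them the destinations are good with probability at least \<open>\<beta>\<close>.\<close>

lemma measure_pair_ge:
  assumes "prob_space M" "prob_space N" and G: "G \<in> sets (M \<Otimes>\<^sub>M N)" and A: "A \<in> sets M"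
    and \<beta>: "\<And>x. x \<in> A \<Longrightarrow> \<beta> \<le> measure N (Pair x -` G)"
    and "0 \<le> \<beta>"
  shows "\<beta> * measure M A \<le> measure (M \<Otimes>\<^sub>M N) G"
proof -
  interpret M: prob_space M by fact
  interpret N: prob_space N by fact
  interpret pair_prob_space M N ..
  have "ennreal (\<beta> * measure M A) = (\<integral>\<^sup>+x. ennreal \<beta> * indicator A x \<partial>M)"
    using A \<open>0 \<le> \<beta>\<close> by (simp add: nn_integral_cmult M.emeasure_eq_measure ennreal_mult)
  also have "\<dots> \<le> (\<integral>\<^sup>+x. emeasure N (Pair x -` G) \<partial>M)"
    using \<beta> by (intro nn_integral_mono) (auto simp: indicator_def N.emeasure_eq_measure ennreal_leI)
  also have "\<dots> = emeasure (M \<Otimes>\<^sub>M N) G"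
    using G by (rule N.emeasure_pair_measure_alt[symmetric])
  finally show ?thesis by (simp add: emeasure_eq_measure)
qed

section \<open>The uniform law on the disk\<close>

abbreviation disk_uniform :: "real \<Rightarrow> point measure" where
  "disk_uniform R \<equiv> uniform_measure lborel (cball 0 R)"

lemma
  assumes "0 < R"
  shows prob_space_disk_uniform: "prob_space (disk_uniform R)"
    and measure_disk_uniform: "B \<in> sets borel \<Longrightarrow> measure (disk_uniform R) B = measure lborel (cball 0 R \<inter> B) / (pi * R\<^sup>2)"
proof -
  have e: "emeasure lborel (cball (0::point) R) = ennreal (pi * R\<^sup>2)"
    using assms by (simp add: emeasure_cball unit_ball_vol_2)
  have ne: "emeasure lborel (cball (0::point) R) \<noteq> 0" "emeasure lborel (cball (0::point) R) \<noteq> \<infinity>"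
    using assms by (auto simp: e)
  show "prob_space (disk_uniform R)" by (rule prob_space_uniform_measure[OF ne])
  show "measure (disk_uniform R) B = measure lborel (cball 0 R \<inter> B) / (pi * R\<^sup>2)" if "B \<in> sets borel"
    using that ne e assms by (simp add: measure_def[of lborel "cball 0 R"])
qed

lemma disk_uniform_strip:
  assumes "0 < h" "3 * h \<le> R"
  shows "measure (disk_uniform R) {x. home_coord R h b x = r} \<le> 6 * h / R"
proof -
  have R: "0 < R" using assms by linarith
  have "measure (disk_uniform R) {x. home_coord R h b x = r} =
      measure lborel (cball 0 R \<inter> {x. home_coord R h b x = r}) / (pi * R\<^sup>2)"
    by (intro measure_disk_uniform R) measurable
  also have "\<dots> \<le> 6 * R * h / (pi * R\<^sup>2)"
    using R by (intro divide_right_mono measure_home_strip assms) auto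
  also have "\<dots> \<le> 6 * R * h / (1 * R\<^sup>2)"
    using R assms pi_ge_two by (intro divide_left_mono mult_right_mono) auto
  also have "\<dots> = 6 * h / R" using R by (simp add: power2_eq_square)
  finally show ?thesis .
qed

lemma sets_home_cell: "{x. home R h x = v} \<in> sets borel"
proof -
  have "{x. home R h x = v} = {x. home_coord R h 1 x = fst v} \<inter> {x. home_coord R h 2 x = snd v}"
    by (auto simp: home_eq_coords)
  also have "\<dots> \<in> sets borel" by measurable
  finally show ?thesis .
qed

lemma disk_uniform_cell:
  assumes "0 < h" "0 < R" "inner_cell (R / h) v"
  shows "h\<^sup>2 / (pi * R\<^sup>2) \<le> measure (disk_uniform R) {x. home R h x = v}"
  using assms measure_home_cell[OF assms]
  by (simp add: measure_disk_uniform sets_home_cell divide_right_mono)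

section \<open>The good event and the schedule that it guarantees\<close>

definition strips :: "real \<Rightarrow> int set" where
  "strips q = {r. \<bar>of_int r\<bar> \<le> q}"

lemma finite_strips: "finite (strips q)"
  and card_strips: "1 \<le> q \<Longrightarrow> real (card (strips q)) \<le> 3 * q"
proof -
  have eq: "strips q = {- \<lfloor>q\<rfloor>..\<lfloor>q\<rfloor>}"
    unfolding strips_def by (auto simp: abs_le_iff) linarith+
  then show "finite (strips q)" by simp
  assume "1 \<le> q"
  then have "real (card (strips q)) = 2 * of_int \<lfloor>q\<rfloor> + 1" by (simp add: eq)
  also have "\<dots> \<le> 3 * q" using \<open>1 \<le> q\<close> by linarith
  finally show "real (card (strips q)) \<le> 3 * q" .
qed

lemma inner_cell_strips:
  assumes "inner_cell q v" "0 \<le> q"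
  shows "fst v \<in> strips q" "snd v \<in> strips q"
proof -
  have ext: "\<bar>of_int c\<bar> \<le> extent c" for c by (simp add: extent_def)
  have "(extent (fst v))\<^sup>2 \<le> q\<^sup>2" "(extent (snd v))\<^sup>2 \<le> q\<^sup>2"
    using assms(1) zero_le_power2[of "extent (fst v)"] zero_le_power2[of "extent (snd v)"]
    unfolding inner_cell_def by linarith+
  then have "extent (fst v) \<le> q" "extent (snd v) \<le> q"
    using assms(2) by (auto intro: power2_le_imp_le)
  then show "fst v \<in> strips q" "snd v \<in> strips q"
    using ext order_trans unfolding strips_def by blast+
qed

text \<open>A strip has probability at most \<open>p = 6 * h / R\<close>. In the tail bound
  \<open>exp (2 * p * n - t)\<close> the threshold 24 is twice the 12 coming from
  \<open>2 * p * n\<close>, which leaves \<open>exp (- 12 * n * (h / R))\<close>.\<close>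

definition good_positions :: "nat \<Rightarrow> real \<Rightarrow> real \<Rightarrow> (nat \<Rightarrow> point) set" where
  "good_positions n R h = {s. (\<forall>i<n. norm (s i) \<le> R) \<and>
     (\<forall>v. inner_cell (R / h) v \<longrightarrow> (\<exists>i<n. home R h (s i) = v)) \<and>
     (\<forall>b. \<forall>r\<in>strips (R / h). real (card {i \<in> {..<n}. home_coord R h b (s i) = r}) \<le> 24 * real n * (h / R))}"

text \<open>For good positions a destination falls into a given strip with probability at most
  \<open>48 * (h / R)\<close>. The threshold 108 = 2 * 48 + 12 leaves the same tail as for the
  positions.\<close>

definition good_destinations :: "nat \<Rightarrow> real \<Rightarrow> real \<Rightarrow> (nat \<Rightarrow> point) \<Rightarrow> (nat \<Rightarrow> nat) set" where
  "good_destinations n R h s = {d. is_dest_map n d \<and>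
     (\<forall>b. \<forall>r\<in>strips (R / h). real (card {i \<in> {..<n}. d i \<in> {j. j < n \<and> home_coord R h b (s j) = r}})
        \<le> 108 * real n * (h / R))}"

definition good_event :: "nat \<Rightarrow> real \<Rightarrow> real \<Rightarrow> ((nat \<Rightarrow> point) \<times> (nat \<Rightarrow> nat)) set" where
  "good_event n R h = {(s, d). s \<in> good_positions n R h \<and> d \<in> good_destinations n R h s}"

lemma good_event_system_exists:
  assumes "0 < n" "0 < h" "3 * h \<le> R" "0 < D" and good: "(s, d) \<in> good_event n R h"
  shows "\<exists>S. is_system n d S \<and> successful (DC (6 * h) D) n s S \<and>
           real (period n S) \<le> 64152 * (2 + D)\<^sup>2 * real n * (h / R)"
proof -
  have R: "0 < R" using assms by linarith
  define X Y where "X = nat \<lfloor>24 * real n * (h / R)\<rfloor>" and "Y = nat \<lfloor>108 * real n * (h / R)\<rfloor>"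
  have nonneg: "0 \<le> 24 * real n * (h / R)" "0 \<le> 108 * real n * (h / R)" using R assms by auto
  have X: "real X \<le> 24 * real n * (h / R)" and Y: "real Y \<le> 108 * real n * (h / R)"
    using nonneg unfolding X_def Y_def by linarith+
  \<comment> \<open>The summand 4 offsets the loss in \<open>same_colour_home_imp_far\<close>, so
    that equal colours are at least \<open>6 * h * (2 + D)\<close> apart. Rounding up costs at most
    1, and 5 is below \<open>3 * (2 + D)\<close>, hence \<open>k \<le> 9 * (2 + D)\<close>.\<close>
  define k where "k = nat \<lceil>6 * (2 + D)\<rceil> + 4"
  have k: "6 * (2 + D) \<le> real k - 4" "real k \<le> 9 * (2 + D)" "0 < k"
    using \<open>0 < D\<close> unfolding k_def by (auto simp: real_nat_ceiling_ge) linarith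
  have pos: "norm (s i) \<le> R" if "i < n" for i
    using good that by (auto simp: good_event_def good_positions_def)
  have dest: "is_dest_map n d" using good by (auto simp: good_event_def good_destinations_def)
  have src: "card {i. i < n \<and> home_coord R h b (s i) = r} \<le> X" if "r \<in> strips (R / h)" for b r
  proof -
    have "real (card {i \<in> {..<n}. home_coord R h b (s i) = r}) \<le> 24 * real n * (h / R)"
      using good that unfolding good_event_def good_positions_def by blast
    then show ?thesis unfolding X_def by (simp add: le_nat_floor)
  qed
  have dst: "card {i. i < n \<and> home_coord R h b (s (d i)) = r} \<le> Y" if "r \<in> strips (R / h)" for b r
  proof -
    have "real (card {i \<in> {..<n}. d i \<in> {j. j < n \<and> home_coord R h b (s j) = r}}) \<le> 108 * real n * (h / R)"
      using good that unfolding good_event_def good_destinations_def by blast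
    moreover have "{i \<in> {..<n}. d i \<in> {j. j < n \<and> home_coord R h b (s j) = r}} =
        {i. i < n \<and> home_coord R h b (s (d i)) = r}"
      using dest by (auto simp: is_dest_map_def)
    ultimately show ?thesis unfolding Y_def by (simp add: le_nat_floor)
  qed
  have "\<exists>S. is_system n d S \<and> successful (DC (6 * h) D) n s S \<and> period n S \<le> k * k * (6 * (X + Y))"
  proof (rule grid_system_exists[where \<kappa> = "\<lambda>i. home R h (s i)" and q = "R / h"])
    show "\<exists>a<n. home R h (s a) = v" if "inner_cell (R / h) v" for v
      using good that unfolding good_event_def good_positions_def by blast
    show "inner_cell (R / h) (home R h (s a))" if "a < n" for a
      using pos[OF that] assms by (intro inner_cell_home) auto
    show "norm (s a - s b) \<le> 6 * h" if "a < n" "b < n" "adjacent (home R h (s a)) (home R h (s b))" for a b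
      using pos that R assms by (intro adjacent_home_imp_near[of h R]) auto
    show "6 * h * (2 + D) \<le> norm (s a - s b)"
      if "a < n" "b < n" "home R h (s a) \<noteq> home R h (s b)"
        "fst (home R h (s a)) mod int k = fst (home R h (s b)) mod int k"
        "snd (home R h (s a)) mod int k = snd (home R h (s b)) mod int k" for a b
    proof -
      have "6 * h * (2 + D) = 6 * (2 + D) * h" by simp
      also have "\<dots> \<le> (real k - 4) * h" using k assms by (intro mult_right_mono) auto
      also have "\<dots> \<le> norm (s a - s b)"
        using same_colour_home_imp_far[of h R "s a" "s b" k] that pos R assms by auto
      finally show ?thesis .
    qed
    have q: "0 \<le> R / h" using R assms by auto
    show "card {i. i < n \<and> fst (home R h (s i)) = fst v} \<le> X \<and> card {i. i < n \<and> snd (home R h (s i)) = snd v} \<le> X"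
      if "inner_cell (R / h) v" for v
      using src inner_cell_strips[OF that q] by (simp add: home_eq_coords)
    show "card {i. i < n \<and> fst (home R h (s (d i))) = fst v} \<le> Y \<and> card {i. i < n \<and> snd (home R h (s (d i))) = snd v} \<le> Y"
      if "inner_cell (R / h) v" for v
      using dst inner_cell_strips[OF that q] by (simp add: home_eq_coords)
  qed (use assms k dest in auto)
  then obtain S where S: "is_system n d S" "successful (DC (6 * h) D) n s S"
    "period n S \<le> k * k * (6 * (X + Y))" by blast
  have "real (period n S) \<le> real k * real k * (6 * (real X + real Y))"
    using S(3) by (metis of_nat_add of_nat_le_iff of_nat_mult of_nat_numeral)
  \<comment> \<open>The constant arises as 9 * 9 * 6 * (24 + 108) = 64152.\<close>
  also have "\<dots> \<le> (9 * (2 + D)) * (9 * (2 + D)) * (6 * (24 * real n * (h / R) + 108 * real n * (h / R)))"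
    using k X Y nonneg \<open>0 < D\<close> by (intro mult_mono add_mono) auto
  also have "\<dots> = 64152 * (2 + D)\<^sup>2 * real n * (h / R)"
    by (simp add: power2_eq_square algebra_simps)
  finally show ?thesis using S by blast
qed

section \<open>Probability bounds for positions and for destinations\<close>

lemma sets_count_tail:
  assumes "finite I" "\<And>i. i \<in> I \<Longrightarrow> A i \<in> sets (M i)"
  shows "{x \<in> space (PiM I M). t < real (card {i \<in> I. x i \<in> A i})} \<in> sets (PiM I M)"
proof -
  have [measurable]: "(\<lambda>x. real (card {i \<in> I. x i \<in> A i})) \<in> borel_measurable (PiM I M)"
    using assms by (intro borel_measurable_card_Collect pred_PiM_component)
  show ?thesis by measurable
qed

text \<open>A union bound over two directions with at most \<open>3 * q\<close> strips each produces
  the factor \<open>6 * q\<close>. The measures \<open>M i\<close> may differ, because each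
  destination is drawn from its own set of candidates.\<close>

lemma PiM_strip_counts:
  fixes A :: "2 \<Rightarrow> int \<Rightarrow> 'i \<Rightarrow> 'a set" and t :: real
  assumes "finite I" and prob: "\<And>i. prob_space (M i)" and "1 \<le> q"
    and A: "\<And>b r i. i \<in> I \<Longrightarrow> A b r i \<in> sets (M i)"
    and p: "\<And>b r i. r \<in> strips q \<Longrightarrow> i \<in> I \<Longrightarrow> measure (M i) (A b r i) \<le> p"
  defines "B \<equiv> (\<Union>(b, r)\<in>UNIV \<times> strips q. {x \<in> space (PiM I M). t < real (card {i \<in> I. x i \<in> A b r i})})"
  shows "B \<in> sets (PiM I M)" and "measure (PiM I M) B \<le> 6 * q * exp (2 * p * card I - t)"
proof -
  interpret product_prob_space M I
    by (rule product_prob_spaceI) (rule prob)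
  let ?O = "\<lambda>(b, r). {x \<in> space (PiM I M). t < real (card {i \<in> I. x i \<in> A b r i})}"
  have O: "?O br \<in> sets (PiM I M)" for br
    using assms(1) A by (cases br) (auto intro!: sets_count_tail)
  have fin: "finite ((UNIV :: 2 set) \<times> strips q)" using finite_strips by auto
  show "B \<in> sets (PiM I M)" unfolding B_def using O fin by (intro sets.finite_UN) auto
  have "measure (PiM I M) B \<le> (\<Sum>br\<in>UNIV \<times> strips q. measure (PiM I M) (?O br))"
    unfolding B_def using O fin by (intro measure_UNION_le) auto
  also have "\<dots> \<le> (\<Sum>br\<in>(UNIV :: 2 set) \<times> strips q. exp (2 * p * card I - t))"
    using assms(1) A p prob by (intro sum_mono) (auto intro!: PiM_count_tail)
  also have "\<dots> = 2 * real (card (strips q)) * exp (2 * p * card I - t)"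
    by (simp add: card_cartesian_product)
  also have "\<dots> \<le> 2 * (3 * q) * exp (2 * p * card I - t)"
    using card_strips[OF \<open>1 \<le> q\<close>] by (intro mult_right_mono mult_left_mono) auto
  finally show "measure (PiM I M) B \<le> 6 * q * exp (2 * p * card I - t)" by simp
qed

text \<open>The product spaces also contain positions outside the disk and inadmissible
  destinations. They form a null set, which a good event excludes along with the bad event
  \<open>B\<close> at no cost in probability.\<close>

lemma (in prob_space) compl_Un_null_prob_ge:
  assumes "B \<in> events" "AE x in M. P x" "{x \<in> space M. P x} \<in> events"
    and "G = space M - (B \<union> {x \<in> space M. \<not> P x})"
  shows "G \<in> events" "1 - prob B \<le> prob G"
proof -
  have N: "{x \<in> space M. \<not> P x} \<in> events"
    using assms(3) by (rule sets.sets_Collect_neg)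
  have N0: "prob {x \<in> space M. \<not> P x} = 0"
    using assms(2) N by (simp add: prob_eq_0)
  show "G \<in> events" using assms N by auto
  have "prob G = 1 - prob (B \<union> {x \<in> space M. \<not> P x})"
    unfolding assms(4) using assms(1) N by (intro prob_compl) auto
  moreover have "prob (B \<union> {x \<in> space M. \<not> P x}) \<le> prob B + prob {x \<in> space M. \<not> P x}"
    using assms(1) N by (rule measure_Un_le)
  ultimately show "1 - prob B \<le> prob G" using N0 by linarith
qed

text \<open>The first error term is a union bound over at most \<open>(3 * (R / h))\<^sup>2\<close>
  inner cells for the event that one is empty; the second is the union bound for overfull
  strips.\<close>

lemma good_positions_prob:
  fixes n :: nat
  assumes "0 < h" "3 * h \<le> R"
  defines "M \<equiv> PiM {..<n} (\<lambda>_. disk_uniform R)"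
  shows "space M \<inter> good_positions n R h \<in> sets M"
    and "1 - (9 * (R / h)\<^sup>2 * exp (- (n * (h / R)\<^sup>2 / pi)) + 6 * (R / h) * exp (- 12 * n * (h / R)))
           \<le> measure M (space M \<inter> good_positions n R h)"
proof -
  have R: "0 < R" and q: "1 \<le> R / h" using assms by (auto simp: field_simps)
  have U: "prob_space (disk_uniform R)" by (rule prob_space_disk_uniform[OF R])
  interpret M: prob_space M unfolding M_def by (intro prob_space_PiM U)
  define V where "V = {v. inner_cell (R / h) v}"
  define E where "E v = {x \<in> space M. \<forall>i\<in>{..<n}. x i \<notin> {y. home R h y = v}}" for v
  define O' where "O' = (\<Union>(b, r)\<in>UNIV \<times> strips (R / h).
    {x \<in> space M. 24 * real n * (h / R) < real (card {i \<in> {..<n}. x i \<in> {y. home_coord R h b y = r}})})"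
  have V: "V \<subseteq> strips (R / h) \<times> strips (R / h)"
    using inner_cell_strips[of "R / h"] q by (auto simp: V_def mem_Times_iff)
  then have finV: "finite V" using finite_strips by (auto intro: finite_subset)
  have comp: "(\<lambda>x. x i) \<in> M \<rightarrow>\<^sub>M borel" if "i < n" for i
    unfolding M_def using that measurable_component_singleton[of i "{..<n}" "\<lambda>_. disk_uniform R"]
    by (simp cong: measurable_cong_sets)
  have sE: "E v \<in> sets M" for v
    unfolding E_def
  proof (intro sets.sets_Collect_finite_All sets.sets_Collect_neg)
    fix i assume "i \<in> {..<n}"
    then show "{x \<in> space M. x i \<in> {y. home R h y = v}} \<in> sets M"
      using pred_sets2[OF sets_home_cell comp, of i R h v] by (auto simp: pred_def)
  qed simp
  have mE: "measure M (E v) \<le> exp (- (h\<^sup>2 / (pi * R\<^sup>2)) * card {..<n})" if "v \<in> V" for v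
    unfolding E_def M_def
    by (rule PiM_avoid_prob) (use U disk_uniform_cell[of h R v] that R assms in \<open>auto simp: V_def sets_home_cell\<close>)
  have UE: "measure M (\<Union>v\<in>V. E v) \<le> 9 * (R / h)\<^sup>2 * exp (- (n * (h / R)\<^sup>2 / pi))"
  proof -
    have "measure M (\<Union>v\<in>V. E v) \<le> (\<Sum>v\<in>V. measure M (E v))"
      using finV sE by (intro measure_UNION_le) auto
    also have "\<dots> \<le> (\<Sum>v\<in>V. exp (- (n * (h / R)\<^sup>2 / pi)))"
      using mE by (intro sum_mono) (auto simp: power_divide mult_ac)
    also have "\<dots> = real (card V) * exp (- (n * (h / R)\<^sup>2 / pi))" by simp
    also have "real (card V) \<le> (3 * (R / h))\<^sup>2"
    proof -
      have "card V \<le> card (strips (R / h) \<times> strips (R / h))"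
        using V finite_strips by (intro card_mono) auto
      then have "real (card V) \<le> (real (card (strips (R / h))))\<^sup>2"
        by (simp add: card_cartesian_product power2_eq_square flip: of_nat_mult)
      also have "\<dots> \<le> (3 * (R / h))\<^sup>2" using card_strips[OF q] by (intro power_mono) auto
      finally show ?thesis .
    qed
    finally show ?thesis by (simp add: power_mult_distrib power_divide)
  qed
  have strip_sets: "{y. home_coord R h b y = r} \<in> sets (disk_uniform R)" for b r
    unfolding sets_uniform_measure sets_lborel by measurable
  have O': "O' \<in> sets M" "measure M O' \<le> 6 * (R / h) * exp (2 * (6 * h / R) * card {..<n} - 24 * real n * (h / R))"
    unfolding O'_def M_def
    using PiM_strip_counts[where I = "{..<n}" and M = "\<lambda>_. disk_uniform R" and q = "R / h"
        and A = "\<lambda>b r _. {y. home_coord R h b y = r}" and p = "6 * h / R" and t = "24 * real n * (h / R)"]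
      U q strip_sets disk_uniform_strip[OF assms(1,2)] by auto
  have sN: "{x \<in> space M. \<forall>i\<in>{..<n}. norm (x i) \<le> R} \<in> sets M"
  proof (intro sets.sets_Collect_finite_All)
    fix i assume "i \<in> {..<n}"
    then show "{x \<in> space M. norm (x i) \<le> R} \<in> sets M"
      using pred_sets2[of "cball 0 R" borel, OF _ comp, of i] by (auto simp: pred_def)
  qed simp
  have AE: "AE x in M. \<forall>i\<in>{..<n}. norm (x i) \<le> R"
  proof (intro AE_finite_allI)
    fix i assume i: "i \<in> {..<n}"
    have "AE y in disk_uniform R. norm y \<le> R"
      by (rule AE_uniform_measureI) auto
    then show "AE x in M. norm (x i) \<le> R"
      unfolding M_def using i U by (intro AE_PiM_component) auto
  qed simp
  have sB: "(\<Union>v\<in>V. E v) \<union> O' \<in> sets M" using sE O' finV by auto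
  have eq: "space M \<inter> good_positions n R h =
     space M - (((\<Union>v\<in>V. E v) \<union> O') \<union> {x \<in> space M. \<not> (\<forall>i\<in>{..<n}. norm (x i) \<le> R)})"
  proof -
    have "x \<in> O' \<longleftrightarrow> x \<in> space M \<and> (\<exists>b. \<exists>r\<in>strips (R / h).
        \<not> real (card {i \<in> {..<n}. home_coord R h b (x i) = r}) \<le> 24 * real n * (h / R))" for x
      unfolding O'_def not_le by auto
    then show ?thesis unfolding good_positions_def E_def V_def Ball_def lessThan_iff by blast
  qed
  show "space M \<inter> good_positions n R h \<in> sets M"
    by (rule M.compl_Un_null_prob_ge(1)[OF sB AE sN eq])
  have "measure M ((\<Union>v\<in>V. E v) \<union> O') \<le> measure M (\<Union>v\<in>V. E v) + measure M O'"
    using sE O' finV by (intro measure_Un_le) auto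
  also note UE
  also have "measure M O' \<le> 6 * (R / h) * exp (- 12 * n * (h / R))"
    using O'(2) by (simp add: mult_ac)
  finally show "1 - (9 * (R / h)\<^sup>2 * exp (- (n * (h / R)\<^sup>2 / pi)) + 6 * (R / h) * exp (- 12 * n * (h / R)))
           \<le> measure M (space M \<inter> good_positions n R h)"
    using M.compl_Un_null_prob_ge(2)[OF sB AE sN eq] by simp
qed

lemma sets_is_dest_map:
  fixes n :: nat shows
  "{d \<in> space (PiM {..<n} (\<lambda>i. measure_pmf (pmf_of_set ({..<n} - {i})))). \<forall>i\<in>{..<n}. d i \<in> {..<n} - {i}}
     \<in> sets (PiM {..<n} (\<lambda>i. measure_pmf (pmf_of_set ({..<n} - {i}))))"
proof (intro sets.sets_Collect_finite_All)
  fix i assume i: "i \<in> {..<n}"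
  show "{d \<in> space (PiM {..<n} (\<lambda>i. measure_pmf (pmf_of_set ({..<n} - {i})))). d i \<in> {..<n} - {i}}
     \<in> sets (PiM {..<n} (\<lambda>i. measure_pmf (pmf_of_set ({..<n} - {i}))))"
    using pred_PiM_component[of i "{..<n}" "{..<n} - {i}" "\<lambda>i. measure_pmf (pmf_of_set ({..<n} - {i}))"] i
    by (auto simp: pred_def)
qed simp

text \<open>Once the positions are fixed, the nodes of a strip form a fixed set and the destinations
  are independent, so the count bound used for positions applies again.\<close>

lemma good_destinations_prob:
  assumes "0 < h" "3 * h \<le> R" "2 \<le> n" and s: "s \<in> good_positions n R h"
  defines "N \<equiv> PiM {..<n} (\<lambda>i. measure_pmf (pmf_of_set ({..<n} - {i})))"
  shows "1 - 6 * (R / h) * exp (- 12 * n * (h / R)) \<le> measure N (space N \<inter> good_destinations n R h s)"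
proof -
  have R: "0 < R" and q: "1 \<le> R / h" using assms by (auto simp: field_simps)
  interpret N: prob_space N unfolding N_def by (intro prob_space_PiM prob_space_measure_pmf)
  define J where "J b r = {j. j < n \<and> home_coord R h b (s j) = r}" for b r
  have ne: "{..<n} - {i} \<noteq> {}" for i
  proof -
    have "(if i = 0 then 1 else 0) \<in> {..<n} - {i}" using assms(3) by auto
    then show ?thesis by blast
  qed
  \<comment> \<open>At most \<open>24 * n * (h / R)\<close> nodes lie in the strip, out of
    \<open>n - 1\<close> candidates, and \<open>n / (n - 1) \<le> 2\<close>.\<close>
  have p: "measure (measure_pmf (pmf_of_set ({..<n} - {i}))) (J b r) \<le> 48 * (h / R)"
    if "r \<in> strips (R / h)" "i \<in> {..<n}" for b r i
  proof -
    have J: "J b r = {i \<in> {..<n}. home_coord R h b (s i) = r}" by (auto simp: J_def)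
    have "real (card (({..<n} - {i}) \<inter> J b r)) \<le> real (card (J b r))"
      by (intro of_nat_mono card_mono) (auto simp: J_def)
    also have "\<dots> \<le> 24 * real n * (h / R)"
      using s that(1) unfolding good_positions_def J by blast
    finally have le: "real (card (({..<n} - {i}) \<inter> J b r)) \<le> 24 * real n * (h / R)" .
    have "real (card ({..<n} - {i})) = real n - 1"
      using that(2) by (simp add: of_nat_diff)
    then have "measure (measure_pmf (pmf_of_set ({..<n} - {i}))) (J b r) =
        real (card (({..<n} - {i}) \<inter> J b r)) / (real n - 1)"
      using measure_pmf_of_set[OF ne, of i "J b r"] by simp
    also have "\<dots> \<le> 24 * real n * (h / R) / (real n - 1)"
      using assms(3) by (intro divide_right_mono[OF le]) simp
    also have "\<dots> = 24 * (real n / (real n - 1)) * (h / R)" by simp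
    also have "\<dots> \<le> 24 * 2 * (h / R)"
      using assms(1,3) R by (intro mult_right_mono mult_left_mono) (auto simp: divide_le_eq)
    also have "\<dots> = 48 * (h / R)" by simp
    finally show ?thesis .
  qed
  define O' where "O' = (\<Union>(b, r)\<in>UNIV \<times> strips (R / h).
    {x \<in> space N. 108 * real n * (h / R) < real (card {i \<in> {..<n}. x i \<in> J b r})})"
  have O': "O' \<in> sets N" "measure N O' \<le> 6 * (R / h) * exp (2 * (48 * (h / R)) * card {..<n} - 108 * real n * (h / R))"
    unfolding O'_def N_def
    using PiM_strip_counts[where I = "{..<n}" and M = "\<lambda>i. measure_pmf (pmf_of_set ({..<n} - {i}))" and q = "R / h"
        and A = "\<lambda>b r _. J b r" and p = "48 * (h / R)" and t = "108 * real n * (h / R)"]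
      prob_space_measure_pmf q p by auto
  have AE: "AE d in N. \<forall>i\<in>{..<n}. d i \<in> {..<n} - {i}"
  proof (intro AE_finite_allI)
    fix i assume i: "i \<in> {..<n}"
    have "AE y in measure_pmf (pmf_of_set ({..<n} - {i})). y \<in> {..<n} - {i}"
      using ne[of i] by (simp add: AE_measure_pmf_iff)
    then show "AE d in N. d i \<in> {..<n} - {i}"
      unfolding N_def using i
      by (intro AE_PiM_component[where P = "\<lambda>y. y \<in> {..<n} - {i}"] prob_space_measure_pmf)
  qed simp
  have eq: "space N \<inter> good_destinations n R h s =
     space N - (O' \<union> {d \<in> space N. \<not> (\<forall>i\<in>{..<n}. d i \<in> {..<n} - {i})})"
  proof -
    have "d \<in> O' \<longleftrightarrow> d \<in> space N \<and> (\<exists>b. \<exists>r\<in>strips (R / h).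
        \<not> real (card {i \<in> {..<n}. d i \<in> {j. j < n \<and> home_coord R h b (s j) = r}}) \<le> 108 * real n * (h / R))" for d
      unfolding O'_def J_def not_le by auto
    then show ?thesis unfolding good_destinations_def is_dest_map_def Ball_def lessThan_iff by blast
  qed
  have "1 - measure N O' \<le> measure N (space N \<inter> good_destinations n R h s)"
    using N.compl_Un_null_prob_ge(2)[OF O'(1) AE _ eq] sets_is_dest_map unfolding N_def by blast
  then show ?thesis using O'(2) by (simp add: mult_ac)
qed

section \<open>Joint measurability and probability of the good event\<close>

lemma sd_space_position_measurable:
  assumes "i < n"
  shows "(\<lambda>\<omega>. fst \<omega> i) \<in> sd_space \<gamma> n \<rightarrow>\<^sub>M borel"
proof -
  have "(\<lambda>\<omega>. fst \<omega> i) \<in> sd_space \<gamma> n \<rightarrow>\<^sub>M disk_uniform (real n powr \<gamma>)"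
    unfolding sd_space_def using assms
    by (intro measurable_compose[OF measurable_fst measurable_component_singleton]) auto
  then show ?thesis by (simp cong: measurable_cong_sets)
qed

lemma sd_space_destination_measurable:
  assumes "i < n"
  shows "(\<lambda>\<omega>. snd \<omega> i) \<in> sd_space \<gamma> n \<rightarrow>\<^sub>M count_space UNIV"
proof -
  have "(\<lambda>\<omega>. snd \<omega> i) \<in> sd_space \<gamma> n \<rightarrow>\<^sub>M measure_pmf (pmf_of_set ({..<n} - {i}))"
    unfolding sd_space_def using assms
    by (intro measurable_compose[OF measurable_snd measurable_component_singleton[where M = "\<lambda>i. measure_pmf (pmf_of_set ({..<n} - {i}))"]]) auto
  then show ?thesis by (simp cong: measurable_cong_sets)
qed

lemma good_event_measurable:
  fixes \<gamma> :: real and n :: nat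
  defines "R \<equiv> real n powr \<gamma>"
  assumes "0 < h" "3 * h \<le> R"
  shows "space (sd_space \<gamma> n) \<inter> good_event n R h \<in> sets (sd_space \<gamma> n)"
proof -
  let ?S = "sd_space \<gamma> n" and ?M = "PiM {..<n} (\<lambda>_. disk_uniform R)"
  note pos = sd_space_position_measurable[of _ n \<gamma>] and dest = sd_space_destination_measurable[of _ n \<gamma>]
  have 1: "{\<omega> \<in> space ?S. fst \<omega> \<in> space ?M \<inter> good_positions n R h} \<in> sets ?S"
  proof -
    have "fst \<in> ?S \<rightarrow>\<^sub>M ?M" unfolding sd_space_def R_def by (rule measurable_fst)
    from pred_sets2[OF good_positions_prob(1)[OF assms(2,3)] this]
    show ?thesis by (simp add: pred_def)
  qed
  have 2: "{\<omega> \<in> space ?S. \<forall>i\<in>{..<n}. snd \<omega> i \<in> {..<n} - {i}} \<in> sets ?S"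
  proof (intro sets.sets_Collect_finite_All)
    fix i assume "i \<in> {..<n}"
    then show "{\<omega> \<in> space ?S. snd \<omega> i \<in> {..<n} - {i}} \<in> sets ?S"
      using pred_sets2[OF _ dest, of "{..<n} - {i}" i] by (simp add: pred_def)
  qed simp
  have count: "{\<omega> \<in> space ?S. real (card {i \<in> {..<n}. snd \<omega> i \<in> {j. j < n \<and> home_coord R h b (fst \<omega> j) = r}})
        \<le> 108 * real n * (h / R)} \<in> sets ?S" for b r
  proof -
    have "Measurable.pred ?S (\<lambda>\<omega>. snd \<omega> i \<in> {j. j < n \<and> home_coord R h b (fst \<omega> j) = r})"
      if "i \<in> {..<n}" for i
    proof -
      \<comment> \<open>The set of nodes in a strip is itself random. Splitting over the finitely
        many values \<open>j\<close> of the destination separates it from the positions.\<close>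
      have "Measurable.pred ?S (\<lambda>\<omega>. \<exists>j\<in>{..<n}. snd \<omega> i \<in> {j} \<and> fst \<omega> j \<in> {x. home_coord R h b x = r})"
        unfolding pred_def
      proof (intro sets.sets_Collect_finite_Ex sets.sets_Collect_conj)
        fix j assume j: "j \<in> {..<n}"
        show "{\<omega> \<in> space ?S. snd \<omega> i \<in> {j}} \<in> sets ?S"
          using pred_sets2[OF _ dest, of "{j}" i] that by (simp add: pred_def)
        have "{x. home_coord R h b x = r} \<in> sets borel" by measurable
        from pred_sets2[OF this pos, of j]
        show "{\<omega> \<in> space ?S. fst \<omega> j \<in> {x. home_coord R h b x = r}} \<in> sets ?S"
          using j by (simp add: pred_def)
      qed simp
      also have "(\<lambda>\<omega>. \<exists>j\<in>{..<n}. snd \<omega> i \<in> {j} \<and> fst \<omega> j \<in> {x. home_coord R h b x = r}) =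
          (\<lambda>\<omega>. snd \<omega> i \<in> {j. j < n \<and> home_coord R h b (fst \<omega> j) = r})"
        by auto
      finally show ?thesis .
    qed
    then have [measurable]: "(\<lambda>\<omega>. real (card {i \<in> {..<n}. snd \<omega> i \<in> {j. j < n \<and> home_coord R h b (fst \<omega> j) = r}}))
        \<in> borel_measurable ?S"
      by (intro borel_measurable_card_Collect) auto
    show ?thesis by measurable
  qed
  have 3: "{\<omega> \<in> space ?S. \<forall>b\<in>UNIV. \<forall>r\<in>strips (R / h).
      real (card {i \<in> {..<n}. snd \<omega> i \<in> {j. j < n \<and> home_coord R h b (fst \<omega> j) = r}})
        \<le> 108 * real n * (h / R)} \<in> sets ?S"
    by (intro sets.sets_Collect_finite_All count finite_strips) auto
  have eq: "space ?S \<inter> good_event n R h =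
    {\<omega> \<in> space ?S. fst \<omega> \<in> space ?M \<inter> good_positions n R h} \<inter>
    {\<omega> \<in> space ?S. \<forall>i\<in>{..<n}. snd \<omega> i \<in> {..<n} - {i}} \<inter>
    {\<omega> \<in> space ?S. \<forall>b\<in>UNIV. \<forall>r\<in>strips (R / h).
      real (card {i \<in> {..<n}. snd \<omega> i \<in> {j. j < n \<and> home_coord R h b (fst \<omega> j) = r}})
        \<le> 108 * real n * (h / R)}"
    unfolding good_event_def good_destinations_def is_dest_map_def
    by (auto simp: sd_space_def space_pair_measure R_def)
  show ?thesis unfolding eq by (intro sets.Int 1 2 3)
qed

lemma prob_space_sd_space:
  assumes "0 < n"
  shows "prob_space (sd_space \<gamma> n)"
proof -
  have "0 < real n powr \<gamma>" using assms by simp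
  then show ?thesis unfolding sd_space_def
    by (intro prob_space_pair prob_space_PiM prob_space_measure_pmf prob_space_disk_uniform)
qed

text \<open>The bounds for the positions and for the destinations given good positions multiply;
  \<open>e \<le> 1\<close> keeps the factor \<open>1 - e\<close> nonnegative.\<close>

lemma good_event_prob:
  fixes \<gamma> h :: real and n :: nat
  defines "R \<equiv> real n powr \<gamma>"
  defines "e \<equiv> 6 * (R / h) * exp (- 12 * n * (h / R))"
  assumes "0 < h" "3 * h \<le> R" "2 \<le> n" "e \<le> 1"
  shows "(1 - e) * (1 - (9 * (R / h)\<^sup>2 * exp (- (n * (h / R)\<^sup>2 / pi)) + e))
           \<le> measure (sd_space \<gamma> n) (space (sd_space \<gamma> n) \<inter> good_event n R h)"
proof -
  let ?M = "PiM {..<n} (\<lambda>_. disk_uniform R)"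
  let ?N = "PiM {..<n} (\<lambda>i. measure_pmf (pmf_of_set ({..<n} - {i})))"
  have sd: "sd_space \<gamma> n = ?M \<Otimes>\<^sub>M ?N" by (simp add: sd_space_def R_def)
  have R: "0 < R" using assms by linarith
  let ?A = "space ?M \<inter> good_positions n R h"
  have meas: "space (sd_space \<gamma> n) \<inter> good_event n R h \<in> sets (sd_space \<gamma> n)"
    using assms(3,4) unfolding R_def by (rule good_event_measurable)
  have "(1 - e) * (1 - (9 * (R / h)\<^sup>2 * exp (- (n * (h / R)\<^sup>2 / pi)) + e)) \<le> (1 - e) * measure ?M ?A"
    unfolding e_def using assms(3-6) by (intro mult_left_mono good_positions_prob) (auto simp: e_def)
  also have "\<dots> \<le> measure (sd_space \<gamma> n) (space (sd_space \<gamma> n) \<inter> good_event n R h)"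
    unfolding sd
  proof (rule measure_pair_ge)
    show "prob_space ?M" by (intro prob_space_PiM prob_space_disk_uniform R)
    show "prob_space ?N" by (intro prob_space_PiM prob_space_measure_pmf)
    show "space (?M \<Otimes>\<^sub>M ?N) \<inter> good_event n R h \<in> sets (?M \<Otimes>\<^sub>M ?N)"
      using meas unfolding sd .
    show "?A \<in> sets ?M" using assms by (intro good_positions_prob) auto
    fix s assume s: "s \<in> ?A"
    have "Pair s -` (space (?M \<Otimes>\<^sub>M ?N) \<inter> good_event n R h) = space ?N \<inter> good_destinations n R h s"
      using s by (auto simp: good_event_def space_pair_measure)
    then show "1 - e \<le> measure ?N (Pair s -` (space (?M \<Otimes>\<^sub>M ?N) \<inter> good_event n R h))"
      using good_destinations_prob[of h R n s] s assms(3-5) by (simp add: e_def)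
  qed (use assms in auto)
  finally show ?thesis .
qed

section \<open>Asymptotics\<close>

text \<open>The divergence hypothesis says that \<open>\<epsilon>\<close>, which is
  \<open>exp (- (a * n * \<rho>\<^sup>2)) / \<rho>\<close> for positive \<rho>, tends to 0. The
  strip bound \<open>e\<close> is at most a multiple of \<epsilon> and the cell bound
  \<open>f\<close> at most a multiple of its square, matching the \<open>1 / \<rho>\<close> strips
  and \<open>1 / \<rho>\<^sup>2\<close> cells up to constants.\<close>

lemma good_event_prob_tendsto:
  fixes \<gamma> :: real and C :: "nat \<Rightarrow> real"
  assumes "\<forall>n. C n > 0"
    and small: "eventually (\<lambda>n. C n / real n powr \<gamma> < 1/2) sequentially"
    and lim: "filterlim (\<lambda>n. (ln (exp 1 / 2) / (2^13 * pi)) * real n * (C n / real n powr \<gamma>)^2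
                        + ln (C n / real n powr \<gamma>)) at_top sequentially"
  shows "(\<lambda>n. measure (sd_space \<gamma> n)
            (space (sd_space \<gamma> n) \<inter> good_event n (real n powr \<gamma>) (C n / 6))) \<longlonglongrightarrow> 1"
proof -
  define a :: real where "a = ln (exp 1 / 2) / (2^13 * pi)"
  define R where "R n = real n powr \<gamma>" for n
  define h where "h n = C n / 6" for n
  define \<rho> where "\<rho> n = C n / R n" for n
  define \<epsilon> where "\<epsilon> n = exp (- (a * real n * (\<rho> n)\<^sup>2 + ln (\<rho> n)))" for n
  define e where "e n = 6 * (R n / h n) * exp (- 12 * n * (h n / R n))" for n
  define f where "f n = 9 * (R n / h n)\<^sup>2 * exp (- (n * (h n / R n)\<^sup>2 / pi))" for n
  have ln_e: "0 \<le> ln (exp 1 / 2 :: real)" "ln (exp 1 / 2 :: real) \<le> 1"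
    using ln_le_minus_one[of "2::real"] by (auto simp: ln_div)
  \<comment> \<open>The empty-cell exponent is \<open>n * \<rho>\<^sup>2 / (36 * pi)\<close>,
    because \<open>h / R = \<rho> / 6\<close>; it must reach
    \<open>2 * a * n * \<rho>\<^sup>2\<close> for the comparison with the square of
    \<epsilon>.\<close>
  have a: "0 \<le> a" "a \<le> 2" "2 * a \<le> 1 / (36 * pi)"
  proof -
    show "0 \<le> a" unfolding a_def using ln_e by simp
    have "a \<le> 1 / (2^13 * pi)" unfolding a_def using ln_e by (intro divide_right_mono) auto
    then have *: "2 * a \<le> 2 / (2^13 * pi)" by simp
    also have "\<dots> \<le> 1 / (36 * pi)" by (simp add: field_simps)
    finally show "2 * a \<le> 1 / (36 * pi)" .
    also have "\<dots> \<le> 1" using pi_ge_two by (simp add: field_simps)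
    finally show "a \<le> 2" by simp
  qed
  have "\<epsilon> \<longlonglongrightarrow> 0"
    unfolding \<epsilon>_def a_def \<rho>_def R_def
    by (rule filterlim_compose[OF exp_at_bot]) (use lim in \<open>simp add: filterlim_uminus_at_top\<close>)
  have ev: "eventually (\<lambda>n. 2 \<le> n \<and> 0 < R n \<and> 0 < h n \<and> 3 * h n \<le> R n \<and> 0 \<le> e n \<and> e n \<le> 36 * \<epsilon> n
      \<and> 0 \<le> f n \<and> f n \<le> 324 * (\<epsilon> n)\<^sup>2) sequentially"
    using small eventually_ge_at_top[of 2]
  proof eventually_elim
    case (elim n)
    have R: "0 < R n" using elim by (simp add: R_def)
    have \<rho>: "0 < \<rho> n" "\<rho> n < 1 / 2" using elim R assms(1) by (auto simp: \<rho>_def R_def)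
    have Rh: "R n / h n = 6 / \<rho> n" "h n / R n = \<rho> n / 6"
      using R by (auto simp: h_def \<rho>_def field_simps)
    have \<epsilon>: "\<epsilon> n = exp (- (a * real n * (\<rho> n)\<^sup>2)) / \<rho> n"
      unfolding \<epsilon>_def using \<rho>(1) by (simp add: exp_diff exp_minus exp_add field_simps)
    \<comment> \<open>The strip exponent \<open>12 * n * (h / R) = 2 * n * \<rho>\<close> is linear
      in \<rho> and exceeds the quadratic one since \<rho> is below 1 and
      \<open>a \<le> 2\<close>.\<close>
    have "a * real n * (\<rho> n)\<^sup>2 \<le> 2 * real n * \<rho> n"
    proof -
      have "(\<rho> n)\<^sup>2 \<le> \<rho> n" using \<rho> by (simp add: power2_eq_square)
      then show ?thesis using a by (intro mult_mono) auto
    qed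
    then have "exp (- 12 * n * (h n / R n)) \<le> exp (- (a * real n * (\<rho> n)\<^sup>2))"
      unfolding Rh by (simp add: mult_ac)
    then have "e n \<le> 6 * (6 / \<rho> n) * exp (- (a * real n * (\<rho> n)\<^sup>2))"
      unfolding e_def Rh using \<rho> by (intro mult_left_mono) auto
    then have e: "e n \<le> 36 * \<epsilon> n" by (simp add: \<epsilon>)
    have "2 * a * (real n * (\<rho> n)\<^sup>2) \<le> 1 / (36 * pi) * (real n * (\<rho> n)\<^sup>2)"
      using a by (intro mult_right_mono) auto
    also have "\<dots> = n * (h n / R n)\<^sup>2 / pi" unfolding Rh by (simp add: power_divide)
    finally have "exp (- (n * (h n / R n)\<^sup>2 / pi)) \<le> exp (- (2 * a * (real n * (\<rho> n)\<^sup>2)))"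
      by simp
    also have "\<dots> = (exp (- (a * real n * (\<rho> n)\<^sup>2)))\<^sup>2"
      by (simp add: power2_eq_square exp_add[symmetric])
    finally have "f n \<le> 9 * (6 / \<rho> n)\<^sup>2 * (exp (- (a * real n * (\<rho> n)\<^sup>2)))\<^sup>2"
      unfolding f_def Rh by (intro mult_left_mono) auto
    then have "f n \<le> 324 * (\<epsilon> n)\<^sup>2" by (simp add: \<epsilon> power_divide)
    moreover have "3 * h n \<le> R n" using \<rho>(2) R by (simp add: h_def \<rho>_def field_simps)
    moreover have "0 \<le> e n" "0 \<le> f n" unfolding e_def f_def Rh using \<rho> by auto
    ultimately show ?case using elim R e assms(1) by (simp add: h_def)
  qed
  have e0: "e \<longlonglongrightarrow> 0"
  proof (rule tendsto_sandwich[of "\<lambda>_. 0"])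
    show "(\<lambda>n. 36 * \<epsilon> n) \<longlonglongrightarrow> 0" using tendsto_mult_left[OF \<open>\<epsilon> \<longlonglongrightarrow> 0\<close>, of 36] by simp
  qed (use ev in \<open>auto elim: eventually_mono\<close>)
  have f0: "f \<longlonglongrightarrow> 0"
  proof (rule tendsto_sandwich[of "\<lambda>_. 0"])
    show "(\<lambda>n. 324 * (\<epsilon> n)\<^sup>2) \<longlonglongrightarrow> 0"
      using tendsto_mult_left[OF tendsto_power[OF \<open>\<epsilon> \<longlonglongrightarrow> 0\<close>, of 2], of 324] by simp
  qed (use ev in \<open>auto elim: eventually_mono\<close>)
  have "eventually (\<lambda>n. e n < 1) sequentially"
    using order_tendstoD(2)[OF e0, of 1] by simp
  with ev have lower: "eventually (\<lambda>n. (1 - e n) * (1 - (f n + e n)) \<le> measure (sd_space \<gamma> n)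
      (space (sd_space \<gamma> n) \<inter> good_event n (R n) (h n))) sequentially"
  proof eventually_elim
    case (elim n)
    then show ?case
      using good_event_prob[where n = n and \<gamma> = \<gamma> and h = "h n"] by (auto simp: R_def e_def f_def)
  qed
  have upper: "eventually (\<lambda>n. measure (sd_space \<gamma> n)
      (space (sd_space \<gamma> n) \<inter> good_event n (R n) (h n)) \<le> 1) sequentially"
    using eventually_gt_at_top[of 0]
    by eventually_elim (rule prob_space.prob_le_1[OF prob_space_sd_space])
  have "(\<lambda>n. (1 - e n) * (1 - (f n + e n))) \<longlonglongrightarrow> (1 - 0) * (1 - (0 + 0))"
    by (intro tendsto_intros e0 f0)
  then have "(\<lambda>n. measure (sd_space \<gamma> n)
      (space (sd_space \<gamma> n) \<inter> good_event n (R n) (h n))) \<longlonglongrightarrow> 1"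
    by (intro tendsto_sandwich[OF lower upper]) auto
  then show ?thesis by (simp add: R_def h_def)
qed

text \<open>Measurability of \<open>E n\<close> has to be supplied: \<open>measure\<close> vanishes
  on non-measurable sets, so monotonicity alone would fail.\<close>

lemma tendsto_prob_1_superset:
  assumes G: "(\<lambda>n. measure (M n) (G n)) \<longlonglongrightarrow> 1"
    and "eventually (\<lambda>n. prob_space (M n) \<and> G n \<subseteq> E n \<and> E n \<in> sets (M n)) sequentially"
  shows "(\<lambda>n. measure (M n) (E n)) \<longlonglongrightarrow> 1"
proof (rule tendsto_sandwich[OF _ _ G tendsto_const])
  show "eventually (\<lambda>n. measure (M n) (G n) \<le> measure (M n) (E n)) sequentially"
    using assms(2)
    by eventually_elim (auto intro: finite_measure.finite_measure_mono prob_space.finite_measure)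
  show "eventually (\<lambda>n. measure (M n) (E n) \<le> 1) sequentially"
    using assms(2) by eventually_elim (auto intro: prob_space.prob_le_1)
qed

section \<open>The fallback system and the two limits\<close>

lemma period_pos:
  assumes "is_system n d S" "0 < n"
  shows "0 < period n S"
proof -
  let ?A = "{hop_slot h | h i. i < n \<and> h \<in> set (S i)}"
  have S0: "S 0 \<noteq> []" "\<forall>h\<in>set (S 0). 1 \<le> hop_slot h"
    using assms by (auto simp: is_system_def valid_route_def)
  have "?A = (\<Union>i<n. hop_slot ` set (S i))" by auto
  then have fin: "finite ?A" by simp
  have "hop_slot (hd (S 0)) \<in> ?A" using S0(1) assms(2) hd_in_set by blast
  with fin have "hop_slot (hd (S 0)) \<le> period n S" unfolding period_def by (rule Max_ge)
  moreover have "1 \<le> hop_slot (hd (S 0))" using S0 by simp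
  ultimately show ?thesis by linarith
qed

text \<open>The fallback outside the good event.  An out-of-range destination is redirected to node 0, so that
  the success of this system depends measurably on the sample.\<close>
definition direct_system :: "nat \<Rightarrow> (nat \<Rightarrow> nat) \<Rightarrow> net_system" where
  "direct_system n d i = [(i, if d i < n then d i else 0, Suc i)]"

lemma is_system_direct: "is_dest_map n d \<Longrightarrow> is_system n d (direct_system n d)"
  by (auto simp: is_system_def valid_route_def compatible_def direct_system_def is_dest_map_def
      hop_tx_def hop_rx_def hop_slot_def)

lemma period_direct: "period n (direct_system n d) = Max (Suc ` {..<n})"
proof -
  have "{hop_slot h | h i. i < n \<and> h \<in> set (direct_system n d i)} = Suc ` {..<n}"
    by (auto simp: direct_system_def hop_slot_def)
  then show ?thesis by (simp add: period_def)
qed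

text \<open>Node \<open>i\<close> is alone in slot \<open>i + 1\<close>, so only the range condition
  is left. The quantifier over \<open>j\<close> replaces the random index of \<open>s\<close> by
  fixed ones, which makes the event a finite combination of measurable ones.\<close>

lemma successful_direct_iff:
  "successful (DC C D) n s (direct_system n d) \<longleftrightarrow>
     (\<forall>i\<in>{..<n}. \<exists>j\<in>{..<n}. (if d i < n then d i else 0) = j \<and> norm (s i - s j) \<le> C)"
proof -
  have hops: "hops_in_slot n (direct_system n d) k =
      {(i, if d i < n then d i else 0) | i. i < n \<and> Suc i = k}" for k
    by (auto simp: hops_in_slot_def direct_system_def hop_tx_def hop_rx_def hop_slot_def)
  have "transmitters n (direct_system n d) (Suc i) - {i} = {}" for i
    by (auto simp: transmitters_def hops)
  then show ?thesis
    by (auto simp: successful_def hops DC_def)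
qed

lemma sets_successful_direct:
  "{\<omega> \<in> space (sd_space \<gamma> n). successful (DC C D) n (fst \<omega>) (direct_system n (snd \<omega>))} \<in> sets (sd_space \<gamma> n)"
  unfolding successful_direct_iff
proof (intro sets.sets_Collect_finite_All sets.sets_Collect_finite_Ex sets.sets_Collect_conj)
  fix i j assume ij: "i \<in> {..<n}" "j \<in> {..<n}"
  have "(\<lambda>\<omega>. snd \<omega> i) \<in> sd_space \<gamma> n \<rightarrow>\<^sub>M count_space UNIV"
    using ij by (intro sd_space_destination_measurable) auto
  from pred_sets2[OF _ this, of "{m. (if m < n then m else 0) = j}"]
  show "{\<omega> \<in> space (sd_space \<gamma> n). (if snd \<omega> i < n then snd \<omega> i else 0) = j} \<in> sets (sd_space \<gamma> n)"
    by (simp add: pred_def)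
  have [measurable]: "(\<lambda>\<omega>. fst \<omega> i) \<in> sd_space \<gamma> n \<rightarrow>\<^sub>M borel" "(\<lambda>\<omega>. fst \<omega> j) \<in> sd_space \<gamma> n \<rightarrow>\<^sub>M borel"
    using ij by (auto intro: sd_space_position_measurable)
  show "{\<omega> \<in> space (sd_space \<gamma> n). norm (fst \<omega> i - fst \<omega> j) \<le> C} \<in> sets (sd_space \<gamma> n)"
    by measurable
qed auto

theorem theorem2:
  fixes \<gamma> :: real and C :: "nat \<Rightarrow> real"
  assumes "\<gamma> \<ge> 0"
    and "\<forall>n. C n > 0"
    and "eventually (\<lambda>n. C n / real n powr \<gamma> < 1/2) sequentially"
    and "filterlim (\<lambda>n. (ln (exp 1 / 2) / (2^13 * pi)) * real n * (C n / real n powr \<gamma>)^2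
                        + ln (C n / real n powr \<gamma>)) at_top sequentially"
  shows "\<exists>Sys :: nat \<Rightarrow> real \<Rightarrow> ((nat \<Rightarrow> point) \<times> (nat \<Rightarrow> nat)) \<Rightarrow> net_system.
           (\<forall>n Dv s d. Dv > 0 \<longrightarrow> is_dest_map n d \<longrightarrow> is_system n d (Sys n Dv (s, d))) \<and>
           (\<forall>D :: nat \<Rightarrow> real. (\<forall>n. D n > 0) \<longrightarrow> (\<forall>W :: real. W > 0 \<longrightarrow>
              ((\<lambda>n. measure (sd_space \<gamma> n)
                   {\<omega> \<in> space (sd_space \<gamma> n).
                      successful (DC (C n) (D n)) n (fst \<omega>) (Sys n (D n) \<omega>)}) \<longlonglongrightarrow> 1) \<and>
              ((\<lambda>n. measure (sd_space \<gamma> n)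
                   {\<omega> \<in> space (sd_space \<gamma> n).
                      throughput W n (Sys n (D n) \<omega>)
                        \<ge> W / ((27 * 2^14) * real n powr (1 - \<gamma>) * C n * (2 + D n)^2)}) \<longlonglongrightarrow> 1)))"
proof -
  define R where "R n = real n powr \<gamma>" for n
  define G where "G n = good_event n (R n) (C n / 6)" for n
  define good_sys where "good_sys n Dv \<omega> S \<longleftrightarrow> is_system n (snd \<omega>) S \<and>
    successful (DC (C n) Dv) n (fst \<omega>) S \<and>
    real (period n S) \<le> 64152 * (2 + Dv)\<^sup>2 * real n * (C n / 6 / R n)"
    for n and Dv :: real and \<omega> :: "(nat \<Rightarrow> point) \<times> (nat \<Rightarrow> nat)" and S
  \<comment> \<open>The fallback provides a system for every \<open>n\<close> and every destination
    map, also before the asymptotic conditions hold. \<open>Dv\<close> is an argument because the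
    sequence \<open>D\<close> is quantified after the system.\<close>
  define Sys where "Sys n Dv \<omega> =
    (if \<omega> \<in> G n \<and> (\<exists>S. good_sys n Dv \<omega> S) then SOME S. good_sys n Dv \<omega> S
     else direct_system n (snd \<omega>))" for n Dv \<omega>
  have Sys_good: "good_sys n Dv \<omega> (Sys n Dv \<omega>)" if "\<omega> \<in> G n" "\<exists>S. good_sys n Dv \<omega> S" for n Dv \<omega>
    using that someI_ex[OF that(2)] by (simp add: Sys_def)
  have Sys_direct: "Sys n Dv \<omega> = direct_system n (snd \<omega>)" if "\<omega> \<notin> G n" for n Dv \<omega>
    using that by (simp add: Sys_def)
  have is_sys: "is_system n d (Sys n Dv (s, d))" if "is_dest_map n d" for n Dv s d
  proof (cases "(s, d) \<in> G n \<and> (\<exists>S. good_sys n Dv (s, d) S)")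
    case True
    then show ?thesis using Sys_good[of "(s, d)" n Dv] by (simp add: good_sys_def)
  next
    case False
    then have "Sys n Dv (s, d) = direct_system n d" unfolding Sys_def by (subst if_not_P) auto
    then show ?thesis using is_system_direct[OF that] by simp
  qed
  have G_lim: "(\<lambda>n. measure (sd_space \<gamma> n) (space (sd_space \<gamma> n) \<inter> G n)) \<longlonglongrightarrow> 1"
    unfolding G_def R_def by (rule good_event_prob_tendsto[OF assms(2-4)])
  have ev: "eventually (\<lambda>n. 0 < n \<and> 3 * (C n / 6) \<le> R n) sequentially"
    using assms(3) eventually_gt_at_top[of 0]
  proof eventually_elim
    case (elim n)
    have "0 < C n" using assms(2) by simp
    with elim show ?case by (simp add: R_def field_simps)
  qed
  have exist: "\<exists>S. good_sys n Dv \<omega> S"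
    if "0 < n" "3 * (C n / 6) \<le> R n" "0 < Dv" "\<omega> \<in> G n" for n Dv \<omega>
    using good_event_system_exists[of n "C n / 6" "R n" Dv "fst \<omega>" "snd \<omega>"] that assms(2)
    by (simp add: good_sys_def G_def)
  have G_sets: "space (sd_space \<gamma> n) \<inter> G n \<in> sets (sd_space \<gamma> n)" if "3 * (C n / 6) \<le> R n" for n
    unfolding G_def R_def using that assms(2) by (intro good_event_measurable) (auto simp: R_def)
  have success: "(\<lambda>n. measure (sd_space \<gamma> n) {\<omega> \<in> space (sd_space \<gamma> n).
      successful (DC (C n) (D n)) n (fst \<omega>) (Sys n (D n) \<omega>)}) \<longlonglongrightarrow> 1" if D: "\<forall>n. 0 < D n" for D
  proof (rule tendsto_prob_1_superset[OF G_lim], use ev in eventually_elim)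
    case (elim n)
    let ?E = "{\<omega> \<in> space (sd_space \<gamma> n). successful (DC (C n) (D n)) n (fst \<omega>) (Sys n (D n) \<omega>)}"
    let ?F = "{\<omega> \<in> space (sd_space \<gamma> n). successful (DC (C n) (D n)) n (fst \<omega>) (direct_system n (snd \<omega>))}"
    have sub: "space (sd_space \<gamma> n) \<inter> G n \<subseteq> ?E"
      using elim D Sys_good exist by (auto simp: good_sys_def)
    \<comment> \<open>A schedule picked by \<open>SOME\<close> depends on the sample in an
      uncontrolled way, but success holds on all of \<open>G n\<close>, and off \<open>G n\<close>
      the system is the direct one. The event is therefore built from two measurable sets.\<close>
    have eq: "?E = (space (sd_space \<gamma> n) \<inter> G n) \<union> (?F - (space (sd_space \<gamma> n) \<inter> G n))"
    proof (rule set_eqI)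
      fix \<omega>
      show "\<omega> \<in> ?E \<longleftrightarrow> \<omega> \<in> (space (sd_space \<gamma> n) \<inter> G n) \<union> (?F - (space (sd_space \<gamma> n) \<inter> G n))"
        using subsetD[OF sub, of \<omega>] Sys_direct[of \<omega> n "D n"] by (cases "\<omega> \<in> G n") auto
    qed
    have "?E \<in> sets (sd_space \<gamma> n)"
      unfolding eq using elim by (intro sets.Un sets.Diff G_sets sets_successful_direct) auto
    then show ?case using elim prob_space_sd_space sub by blast
  qed
  have throughput: "(\<lambda>n. measure (sd_space \<gamma> n) {\<omega> \<in> space (sd_space \<gamma> n).
      throughput W n (Sys n (D n) \<omega>)
        \<ge> W / ((27 * 2^14) * real n powr (1 - \<gamma>) * C n * (2 + D n)^2)}) \<longlonglongrightarrow> 1"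
    if D: "\<forall>n. 0 < D n" and W: "0 < W" for D W
  proof (rule tendsto_prob_1_superset[OF G_lim], use ev in eventually_elim)
    case (elim n)
    let ?b = "(27 * 2^14) * real n powr (1 - \<gamma>) * C n * (2 + D n)^2"
    let ?E = "{\<omega> \<in> space (sd_space \<gamma> n). throughput W n (Sys n (D n) \<omega>) \<ge> W / ?b}"
    have "W / ?b \<le> throughput W n (Sys n (D n) \<omega>)" if "\<omega> \<in> G n" for \<omega>
    proof -
      have good: "good_sys n (D n) \<omega> (Sys n (D n) \<omega>)"
        using elim D that Sys_good exist by blast
      then have pos: "0 < period n (Sys n (D n) \<omega>)"
        using elim by (auto simp: good_sys_def intro: period_pos)
      have "real (period n (Sys n (D n) \<omega>)) \<le> 64152 * (2 + D n)\<^sup>2 * real n * (C n / 6 / R n)"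
        using good by (simp add: good_sys_def)
      \<comment> \<open>Here 10692 = 64152 / 6, and \<open>n / n powr \<gamma>\<close> becomes
        \<open>n powr (1 - \<gamma>)\<close>. The target constant is 27 * 2^14 = 442368.\<close>
      also have "\<dots> = 10692 * (real n powr (1 - \<gamma>) * C n * (2 + D n)\<^sup>2)"
        using elim by (simp add: R_def powr_diff)
      also have "\<dots> \<le> (27 * 2^14) * (real n powr (1 - \<gamma>) * C n * (2 + D n)\<^sup>2)"
        using assms(2) by (intro mult_right_mono mult_nonneg_nonneg) (auto intro: less_imp_le)
      finally have "real (period n (Sys n (D n) \<omega>)) \<le> ?b" by (simp add: mult_ac)
      then show ?thesis
        unfolding throughput_def using pos W by (intro frac_le) auto
    qed
    then have sub: "space (sd_space \<gamma> n) \<inter> G n \<subseteq> ?E" by auto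
    \<comment> \<open>Off \<open>G n\<close> the period is that of the direct system, the same for
      every sample, so this part of the event is everything or nothing.\<close>
    have eq: "?E = (space (sd_space \<gamma> n) \<inter> G n) \<union>
        ((if W / ?b \<le> W / real (Max (Suc ` {..<n})) then space (sd_space \<gamma> n) else {})
          - (space (sd_space \<gamma> n) \<inter> G n))" (is "_ = ?F")
    proof (rule set_eqI)
      fix \<omega>
      show "\<omega> \<in> ?E \<longleftrightarrow> \<omega> \<in> ?F"
        using subsetD[OF sub, of \<omega>] Sys_direct[of \<omega> n "D n"]
        by (cases "\<omega> \<in> G n") (auto simp: throughput_def period_direct)
    qed
    have "?F \<in> sets (sd_space \<gamma> n)"
      using G_sets[of n] elim by (intro sets.Un sets.Diff) auto
    then have "?E \<in> sets (sd_space \<gamma> n)" unfolding eq .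
    then show ?case using elim prob_space_sd_space sub by blast
  qed
  show ?thesis using is_sys success throughput by (intro exI[of _ Sys]) blast
qed

end
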